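(* Let $M$ be a commutative monoid (written additively), let $\mu \colon M \times M \to M$ be a biadditive binary operation, and assume that $M$ is weakly $\mu$-localizable. Then the relations $$\mu(a,b) \approx \mu(b,a) \qquad\text{and}\qquad \mu\bigl(\mu(a,b),c\bigr) \approx \mu\bigl(a,\mu(b,c)\bigr)$$ hold for all $a,b,c \in M$.
   Context: $\mathbb{N} = \{1,2,3,\dots\}$. A commutative monoid is a set $M$ with an associative and commutative operation $+$ having a neutral element $0$. Canonical quasi-order on $M$: for $a,b\in M$, $a \lesssim b$ means that there exist $c,t \in M$ and $k \in \mathbb{N}$ such that $ka + c + t = kb + t$. Equivalence relation on $M$: for $a,b \in M$, $a \approx b$ means that there is $d \in M$ such that $\ell a \lesssim \ell b + d$ and $\ell b \lesssim \ell a + d$ hold for all $\ell \in \mathbb{N}$. A map $\Phi$ between commutative monoids is additive if $\Phi(a+b) = \Phi(a)+\Phi(b)$ for all $a,b$ (preservation of $0$ is not required). A binary operation $\mu\colon M\times M\to M$ is biadditive if for every $b\in M$ the maps $a\mapsto \mu(a,b)$ and $a \mapsto \mu(b,a)$ are additive. No associativity or commutativity of $\mu$ is assumed. The opposite operation is $\mu^{\mathrm{op}}(a,b) := \mu(b,a)$. Localizability: an element $s \in M$ is left $\mu$-localizable if for all $a,b\in M$, $\mu(s,a)+a \lesssim \mu(s,b)+b$ implies $a \lesssim b$. An element $s$ is $\mu$-localizable if it is both left $\mu$-localizable and left $\mu^{\mathrm{op}}$-localizable. $M$ is weakly $\mu$-localizable if for every $a\in M$ there exists a $\mu$-localizable $s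 \in M$ such that $a \lesssim s$. *)

theory Defs
  imports Main
begin

text \<open>
  A commutative monoid is a type of class \<^class>\<open>comm_monoid_add\<close>; the positive natural numbers
  are the \<^typ>\<open>nat\<close>s with \<open>1 \<le> k\<close>.
\<close>

definition nmult :: "nat \<Rightarrow> 'a::comm_monoid_add \<Rightarrow> 'a"  (infixr \<open>\<cdot>\<close> 75)
  where "k \<cdot> a = (\<Sum>i<k. a)"

definition qle :: "'a::comm_monoid_add \<Rightarrow> 'a \<Rightarrow> bool"  (infix \<open>\<lesssim>\<close> 50)
  where "a \<lesssim> b \<longleftrightarrow> (\<exists>c t. \<exists>k\<ge>1. k \<cdot> a + c + t = k \<cdot> b + t)"

definition qequiv :: "'a::comm_monoid_add \<Rightarrow> 'a \<Rightarrow> bool"  (infix \<open>\<approx>\<close> 50)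
  where "a \<approx> b \<longleftrightarrow> (\<exists>d. \<forall>l\<ge>1. l \<cdot> a \<lesssim> l \<cdot> b + d \<and> l \<cdot> b \<lesssim> l \<cdot> a + d)"

text \<open>
  Additive maps need not preserve \<open>0\<close>. (The library's locale \<open>additive\<close> is restricted to
  abelian groups.)
\<close>

definition additive_map :: "('a::comm_monoid_add \<Rightarrow> 'b::comm_monoid_add) \<Rightarrow> bool"
  where "additive_map \<Phi> \<longleftrightarrow> (\<forall>a b. \<Phi> (a + b) = \<Phi> a + \<Phi> b)"

definition biadditive :: "('a::comm_monoid_add \<Rightarrow> 'a \<Rightarrow> 'a) \<Rightarrow> bool"
  where "biadditive \<mu> \<longleftrightarrow> (\<forall>b. additive_map (\<lambda>a. \<mu> a b) \<and> additive_map (\<lambda>a. \<mu> b a))"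

definition opposite :: "('a \<Rightarrow> 'a \<Rightarrow> 'a) \<Rightarrow> 'a \<Rightarrow> 'a \<Rightarrow> 'a"
  where "opposite \<mu> a b = \<mu> b a"

definition left_localizable :: "('a::comm_monoid_add \<Rightarrow> 'a \<Rightarrow> 'a) \<Rightarrow> 'a \<Rightarrow> bool"
  where "left_localizable \<mu> s \<longleftrightarrow> (\<forall>a b. \<mu> s a + a \<lesssim> \<mu> s b + b \<longrightarrow> a \<lesssim> b)"

definition localizable :: "('a::comm_monoid_add \<Rightarrow> 'a \<Rightarrow> 'a) \<Rightarrow> 'a \<Rightarrow> bool"
  where "localizable \<mu> s \<longleftrightarrow> left_localizable \<mu> s \<and> left_localizable (opposite \<mu>) s"

definition weakly_localizable :: "('a::comm_monoid_add \<Rightarrow> 'a \<Rightarrow> 'a) \<Rightarrow> bool"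
  where "weakly_localizable \<mu> \<longleftrightarrow> (\<forall>a. \<exists>s. localizable \<mu> s \<and> a \<lesssim> s)"

end

theory Submission
  imports Defs
begin

text \<open>
  Dividing the differences of elements of \<open>M\<close> by the equivalence that the quasi-order induces gives a
  partially ordered abelian group, the envelope of \<open>M\<close>, in which \<open>n x \<ge> 0\<close> implies \<open>x \<ge> 0\<close>. There
  \<open>\<mu>\<close> becomes a biadditive product of positive elements with positive values, \<open>\<approx>\<close> says that a
  difference is infinitesimal (all its integer multiples lie between \<open>-d\<close> and \<open>d\<close> for one \<open>d\<close>), and
  an element \<open>s\<close> is localizable if the positive operators \<open>L\<^sub>s x = s x\<close> and \<open>R\<^sub>s x = x s\<close> are
  localizing: \<open>(1 + L\<^sub>s) x \<ge> 0\<close> implies \<open>x \<ge> 0\<close>, and the same for \<open>R\<^sub>s\<close>. So \<open>1 + L\<^sub>s\<close> can be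
  cancelled on the left of an inequality, as if its inverse were a positive operator. Associativity
  says that \<open>L\<^sub>a\<close> and \<open>R\<^sub>c\<close> commute.

  The reason for commutation is classical. Let \<open>0 \<le> A \<le> N\<close> be positive operators, think of \<open>A / N\<close> as
  taking values in \<open>[0, 1]\<close>, and let a positive \<open>T\<close> satisfy \<open>T \<le> Q\<close>, where \<open>Q\<close> commutes with \<open>A\<close>
  and \<open>N\<close>. Where \<open>A / N\<close> is close to \<open>k / n\<close>, both \<open>A T N\<close> and \<open>N T A\<close> are close to \<open>(k / n) N T N\<close>, so
  their difference is bounded by \<open>|n A - k N|\<close>, hence by the square \<open>(n A - k N)\<^sup>2\<close>. This bound holds
  for every \<open>k\<close>, and averaging it with the Bernstein weights \<open>A\<^sup>k (N - A)\<^sup>n\<^sup>-\<^sup>k\<close> leaves only the variance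
  \<open>n A (N - A)\<close>, which is small against the factor \<open>n\<close> gained on the other side.
  The average is taken in \<open>n\<close> steps, and after each step one factor \<open>N\<close> is
  cancelled on the left (\<open>quad_descent\<close>). The same steps in the opposite direction show that
  the squares in question are positive (\<open>quad_nearly_nonneg\<close>). Doing one step at a time keeps the
  errors under control when \<open>A\<close> and \<open>N\<close> commute only up to infinitesimals: the error stays below
  one fixed element, however many steps are made. The outcome is the pair of lemmas
  \<open>dominated_nearly_commutes\<close> (for \<open>A = L\<^sub>s\<close>, \<open>N = 1 + L\<^sub>s\<close>) and \<open>nearly_commute_between\<close> (for
  \<open>A \<le> L\<^sub>s\<close>).

  For \<open>a, b \<le> s\<close> with \<open>s\<close> localizable they give \<open>L\<^sub>a L\<^sub>s \<approx> L\<^sub>s L\<^sub>a\<close> and then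
  \<open>L\<^sub>a L\<^sub>b \<approx> L\<^sub>b L\<^sub>a\<close>; the same holds for right multiplications. For \<open>L\<^sub>s\<close> and \<open>R\<^sub>t\<close> there is at first
  no dominating operator that is known to commute with \<open>L\<^sub>s\<close>. But the relations already obtained imply
  that \<open>S = L\<^sub>s\<close> and \<open>T = R\<^sub>t\<close> commute on the vectors \<open>S x\<close>, so that positivity of
  \<open>S T q(S) x\<close> for a polynomial \<open>q\<close> that is positive on \<open>[0, \<infinity>)\<close> reads
  \<open>q(S) T S x + q(0) (S T x - T S x) \<ge> 0\<close>. Choosing \<open>q\<close> with a zero at a point \<open>c > 0\<close> shows that
  \<open>S T x - T S x\<close> is nearly positive where \<open>S\<close> is close to \<open>c\<close>; where \<open>S\<close> is close to \<open>0\<close>, the vector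
  \<open>T S x\<close> is itself small (\<open>half_commute\<close>). Exchanging left and right gives the other
  inequality. The general lemmas then extend the relation from localizable \<open>s, t\<close> to all \<open>a, c\<close>,
  which is associativity up to infinitesimals.

  Finally \<open>(a b) s \<approx> a (b s) \<approx> b (a s) \<approx> (b a) s\<close>, so \<open>R\<^sub>s\<close> annihilates the commutator of \<open>a\<close> and
  \<open>b\<close> up to infinitesimals, while this commutator is at most \<open>a b \<le> R\<^sub>s a\<close> and therefore small where
  \<open>R\<^sub>s\<close> is small (\<open>negligible_by_localization\<close>). Hence it is infinitesimal.
\<close>

section \<open>Integer multiples in unperforated ordered groups\<close>

lemma nmult_0 [simp]: "0 \<cdot> a = 0"
  by (simp add: nmult_def)

lemma nmult_Suc [simp]: "Suc k \<cdot> a = k \<cdot> a + a"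
  by (simp add: nmult_def)

lemma nmult_1 [simp]: "1 \<cdot> a = a"
  by (simp add: nmult_def)

lemma nmult_add_left: "(k + l) \<cdot> a = k \<cdot> a + l \<cdot> a"
  by (induction k) (simp_all add: ac_simps)

lemma nmult_add_right: "k \<cdot> (a + b) = k \<cdot> a + k \<cdot> b"
  by (simp add: nmult_def sum.distrib)

lemma nmult_nmult: "k \<cdot> l \<cdot> a = (k * l) \<cdot> a"
  by (induction k) (simp_all add: nmult_add_left ac_simps)

class unperforated_group = ordered_ab_group_add +
  assumes unperforated: "1 \<le> (k::nat) \<Longrightarrow> 0 \<le> (\<Sum>i<k. x) \<Longrightarrow> 0 \<le> x"

definition scale :: "int \<Rightarrow> 'v::ab_group_add \<Rightarrow> 'v"  (infixr \<open>\<star>\<close> 75)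
  where "k \<star> x = nat k \<cdot> x - nat (- k) \<cdot> x"

text \<open>
  Every law for integer multiples reduces to natural multiples through this formula, whichever way the
  integer is written as a difference.
\<close>

lemma scale_of_difference: "(int m - int n) \<star> x = m \<cdot> x - n \<cdot> x"
proof (cases "n \<le> m")
  case True
  then show ?thesis
    using nmult_add_left[of "m - n" n x] by (simp add: scale_def nat_diff_distrib)
next
  case False
  then show ?thesis
    using nmult_add_left[of "n - m" m x] by (simp add: scale_def nat_diff_distrib)
qed

lemma scale_add_left: "(k + l) \<star> x = k \<star> x + l \<star> x" for x :: "'v::ab_group_add"
proof -
  obtain a b c d where kl: "k = int a - int b" "l = int c - int d"
    by (metis int_diff_cases)
  have "k + l = int (a + c) - int (b + d)"
    using kl by simp
  then have "(k + l) \<star> x = (a + c) \<cdot> x - (b + d) \<cdot> x"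
    by (simp only: scale_of_difference)
  then show ?thesis
    by (simp add: kl scale_of_difference nmult_add_left)
qed

lemma scale_add_right: "k \<star> (x + y) = k \<star> x + k \<star> y" for x :: "'v::ab_group_add"
  by (simp add: scale_def nmult_add_right)

lemma scale_of_nat: "int m \<star> x = m \<cdot> x"
  using scale_of_difference[of m 0 x] by simp

lemma scale_zero_left [simp]: "0 \<star> x = 0"
  by (simp add: scale_def)

lemma scale_one [simp]: "1 \<star> x = x"
  by (simp add: scale_def)

lemma scale_zero_right [simp]: "k \<star> (0::'v::ab_group_add) = 0"
  using scale_add_right[of k "0::'v" 0] by simp

lemma scale_minus_right: "k \<star> (- x) = - (k \<star> x)"
  using scale_add_right[of k x "- x"] by (simp add: eq_neg_iff_add_eq_0 add.commute)

lemma scale_minus_left: "(- k) \<star> x = - (k \<star> x)"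
  by (simp add: scale_def)

lemma scale_diff_left: "(k - l) \<star> x = k \<star> x - l \<star> x"
  using scale_add_left[of "k - l" l x] by simp

lemma scale_diff_right: "k \<star> (x - y) = k \<star> x - k \<star> y"
  using scale_add_right[of k "x - y" y] by simp

lemma scale_two: "2 \<star> x = x + x"
  using scale_add_left[of 1 1 x] by simp

definition additive_op :: "('v::ab_group_add \<Rightarrow> 'v) \<Rightarrow> bool"
  where "additive_op F \<longleftrightarrow> (\<forall>x y. F (x + y) = F x + F y)"

lemma additive_op_add: "additive_op F \<Longrightarrow> F (x + y) = F x + F y"
  by (simp add: additive_op_def)

lemma additive_op_0: "additive_op F \<Longrightarrow> F 0 = 0"
  using additive_op_add[of F 0 0] by simp

lemma additive_op_minus: "additive_op F \<Longrightarrow> F (- x) = - F x"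
  using additive_op_add[of F x "- x"] by (simp add: additive_op_0 eq_neg_iff_add_eq_0 add.commute)

lemma additive_op_diff: "additive_op F \<Longrightarrow> F (x - y) = F x - F y"
  using additive_op_add[of F "x - y" y] by simp

lemma additive_op_nmult: "additive_op F \<Longrightarrow> F (k \<cdot> x) = k \<cdot> F x"
  by (induction k) (simp_all add: additive_op_0 additive_op_add)

lemma additive_op_scale: "additive_op F \<Longrightarrow> F (k \<star> x) = k \<star> F x"
  by (simp add: scale_def additive_op_diff additive_op_nmult)

lemma scale_scale: "k \<star> l \<star> x = (k * l) \<star> x" for x :: "'v::ab_group_add"
proof -
  obtain c d where l: "l = int c - int d"
    by (metis int_diff_cases)
  have k: "additive_op ((\<star>) k :: 'v \<Rightarrow> 'v)"
    by (simp add: additive_op_def scale_add_right)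
  obtain a b where kk: "k = int a - int b"
    by (metis int_diff_cases)
  have "(k * l) = int (a * c + b * d) - int (a * d + b * c)"
    by (simp add: kk l algebra_simps)
  then have "(k * l) \<star> x = (a * c + b * d) \<cdot> x - (a * d + b * c) \<cdot> x"
    by (simp only: scale_of_difference)
  moreover have "k \<star> l \<star> x = c \<cdot> (k \<star> x) - d \<cdot> (k \<star> x)"
    by (simp add: l scale_of_difference additive_op_diff[OF k] additive_op_nmult[OF k])
  moreover have "c \<cdot> (k \<star> x) = (a * c) \<cdot> x - (b * c) \<cdot> x" for c
    using additive_op_nmult[OF k, of c x] nmult_nmult[of a c x] nmult_nmult[of b c x]
    by (simp add: kk scale_of_difference)
  ultimately show ?thesis
    by (simp only: nmult_add_left) (simp add: diff_diff_eq2 diff_diff_eq ac_simps)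
qed

lemmas scale_expand =
  scale_add_left scale_add_right scale_diff_left scale_diff_right scale_minus_left
  scale_minus_right scale_scale scale_zero_left scale_zero_right scale_one scale_two

lemmas operator_expand = additive_op_add additive_op_diff additive_op_minus additive_op_scale

text \<open>
  Expands both sides of an identity into sums of vectors with monomial coefficients. A coefficient
  \<open>2\<close> is split into two summands, so that equal vectors cancel without collecting terms.
\<close>

lemmas linear_normalize = scale_expand operator_expand algebra_simps mult_2 mult_2_right

lemma scale_nonneg: "0 \<le> k \<Longrightarrow> 0 \<le> x \<Longrightarrow> 0 \<le> k \<star> x" for x :: "'v::ordered_ab_group_add"
proof -
  have "0 \<le> x \<Longrightarrow> 0 \<le> m \<cdot> x" for m :: nat
    by (induction m) simp_all
  then show "0 \<le> k \<Longrightarrow> 0 \<le> x \<Longrightarrow> 0 \<le> k \<star> x"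
    by (simp add: scale_def)
qed

lemma scale_left_mono: "0 \<le> k \<Longrightarrow> x \<le> y \<Longrightarrow> k \<star> x \<le> k \<star> y" for x :: "'v::ordered_ab_group_add"
  using scale_nonneg[of k "y - x"] by (simp add: scale_diff_right)

lemma scale_right_mono: "k \<le> l \<Longrightarrow> 0 \<le> x \<Longrightarrow> k \<star> x \<le> l \<star> x" for x :: "'v::ordered_ab_group_add"
  using scale_nonneg[of "l - k" x] by (simp add: scale_diff_left)

lemma scale_nonneg_cancel: "0 < k \<Longrightarrow> 0 \<le> k \<star> x \<Longrightarrow> 0 \<le> x" for x :: "'v::unperforated_group"
  using unperforated[of "nat k" x] by (simp add: scale_def nmult_def)

lemma scale_le_cancel: "0 < k \<Longrightarrow> k \<star> x \<le> k \<star> y \<Longrightarrow> x \<le> y" for x :: "'v::unperforated_group"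
  using scale_nonneg_cancel[of k "y - x"] by (simp add: scale_diff_right)

section \<open>Positive operators and infinitesimals\<close>

definition positive_op :: "('v::ordered_ab_group_add \<Rightarrow> 'v) \<Rightarrow> bool"
  where "positive_op F \<longleftrightarrow> additive_op F \<and> (\<forall>x\<ge>0. 0 \<le> F x)"

lemma positive_opI:
  "(\<And>x y. F (x + y) = F x + F y) \<Longrightarrow> (\<And>x. 0 \<le> x \<Longrightarrow> 0 \<le> F x) \<Longrightarrow> positive_op F"
  by (simp add: positive_op_def additive_op_def)

lemma positive_op_additive: "positive_op F \<Longrightarrow> additive_op F"
  by (simp add: positive_op_def)

lemma positive_op_nonneg: "positive_op F \<Longrightarrow> 0 \<le> x \<Longrightarrow> 0 \<le> F x"
  by (simp add: positive_op_def)

lemma positive_op_mono: "positive_op F \<Longrightarrow> x \<le> y \<Longrightarrow> F x \<le> F y"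
  using positive_op_nonneg[of F "y - x"] by (simp add: additive_op_diff positive_op_additive)

text \<open>
  \<open>negligible d x\<close> reads ``\<open>x \<le> d / k\<close> for every \<open>k\<close>''. The bound \<open>d\<close> is kept explicit
  because error terms whose coefficients depend on \<open>n\<close> have to stay below one bound that does not.
\<close>

definition negligible :: "'v::ordered_ab_group_add \<Rightarrow> 'v \<Rightarrow> bool"
  where "negligible d x \<longleftrightarrow> 0 \<le> d \<and> (\<forall>k\<ge>1. k \<star> x \<le> d)"

definition small :: "'v::ordered_ab_group_add \<Rightarrow> 'v \<Rightarrow> bool"
  where "small d x \<longleftrightarrow> negligible d x \<and> negligible d (- x)"

definition infinitesimal :: "'v::ordered_ab_group_add \<Rightarrow> bool"
  where "infinitesimal x \<longleftrightarrow> (\<exists>d. small d x)"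

lemma negligible_bound_nonneg: "negligible d x \<Longrightarrow> 0 \<le> d"
  by (simp add: negligible_def)

lemma negligible_scale_le: "negligible d x \<Longrightarrow> 0 \<le> k \<Longrightarrow> k \<star> x \<le> d"
  by (cases "k = 0") (simp_all add: negligible_def)

lemma nonpos_negligible:
  assumes "x \<le> 0" "0 \<le> d"
  shows "negligible d x"
proof -
  have "k \<star> x \<le> d" if "1 \<le> k" for k
    using scale_left_mono[of k x 0] assms that by simp
  then show ?thesis
    using assms(2) by (simp add: negligible_def)
qed

lemma negligible_mono: "negligible d x \<Longrightarrow> y \<le> x \<Longrightarrow> d \<le> e \<Longrightarrow> negligible e y"
  unfolding negligible_def
  by (meson order_trans scale_left_mono zero_le_one)

lemma negligible_add: "negligible d x \<Longrightarrow> negligible e y \<Longrightarrow> negligible (d + e) (x + y)"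
  by (simp add: negligible_def scale_add_right add_mono)

text \<open>
  The bound does not grow: each summand is taken with the double multiple, and the factor \<open>2\<close> is
  cancelled at the end.
\<close>

lemma negligible_add_same:
  fixes d :: "'v::unperforated_group"
  assumes "negligible d x" "negligible d y"
  shows "negligible d (x + y)"
  unfolding negligible_def
proof (intro conjI allI impI)
  show "0 \<le> d"
    using assms by (simp add: negligible_def)
  fix k :: int
  assume "1 \<le> k"
  then have "(2 * k) \<star> x + (2 * k) \<star> y \<le> d + d"
    using assms by (intro add_mono) (simp_all add: negligible_def)
  then have "2 \<star> k \<star> (x + y) \<le> 2 \<star> d"
    by (simp add: scale_scale scale_add_right flip: scale_two)
  then show "k \<star> (x + y) \<le> d"
    by (rule scale_le_cancel[rotated]) simp
qed

lemma negligible_scale: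
  assumes "negligible d x" "0 \<le> k"
  shows "negligible d (k \<star> x)"
  using assms
  by (auto simp: negligible_def scale_scale intro!: negligible_scale_le[OF assms(1)])

lemma negligible_image:
  assumes "positive_op F" "negligible d x"
  shows "negligible (F d) (F x)"
  using assms positive_op_mono[OF assms(1), of "k \<star> x" d for k]
  by (simp add: negligible_def positive_op_nonneg additive_op_scale[OF positive_op_additive[OF assms(1)]])

lemma small_0: "0 \<le> d \<Longrightarrow> small d 0"
  by (simp add: small_def nonpos_negligible)

lemma small_minus: "small d x \<Longrightarrow> small d (- x)"
  by (simp add: small_def)

lemma small_mono: "small d x \<Longrightarrow> d \<le> e \<Longrightarrow> small e x"
  using negligible_mono[of d x x e] negligible_mono[of d "- x" "- x" e] by (simp add: small_def)

lemma small_add: "small d x \<Longrightarrow> small d y \<Longrightarrow> small d (x + y)" for d :: "'v::unperforated_group"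
  using negligible_add_same[of d "- x" "- y"] by (simp add: small_def negligible_add_same)

lemma small_diff: "small d x \<Longrightarrow> small d y \<Longrightarrow> small d (x - y)" for d :: "'v::unperforated_group"
  using small_add[of d x "- y"] by (simp add: small_minus)

lemma small_scale:
  assumes "small d x"
  shows "small d (k \<star> x)"
proof (cases "0 \<le> k")
  case True
  then show ?thesis
    using assms negligible_scale[of d x k] negligible_scale[of d "- x" k]
    by (simp add: small_def scale_minus_right)
next
  case False
  then show ?thesis
    using assms negligible_scale[of d x "- k"] negligible_scale[of d "- x" "- k"]
    by (simp add: small_def scale_minus_right scale_minus_left)
qed

lemma small_image: "positive_op F \<Longrightarrow> small d x \<Longrightarrow> small (F d) (F x)"
  using negligible_image[of F d x] negligible_image[of F d "- x"]
  by (simp add: small_def additive_op_minus positive_op_additive)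

lemma infinitesimalE:
  assumes "infinitesimal x"
  obtains d where "0 \<le> d" "small d x"
  using assms by (auto simp: infinitesimal_def small_def negligible_def)

lemma infinitesimal_add:
  fixes x :: "'v::unperforated_group"
  assumes "infinitesimal x" "infinitesimal y"
  shows "infinitesimal (x + y)"
proof -
  obtain d e where "0 \<le> d" "small d x" "0 \<le> e" "small e y"
    using assms by (elim infinitesimalE)
  then have "small (d + e) (x + y)"
    using small_mono[of d x "d + e"] small_mono[of e y "d + e"] by (simp add: small_add)
  then show ?thesis
    by (auto simp: infinitesimal_def)
qed

lemma infinitesimal_minus: "infinitesimal x \<Longrightarrow> infinitesimal (- x)"
  by (auto simp: infinitesimal_def intro: small_minus)

lemma infinitesimal_minus_commute: "infinitesimal (x - y) \<Longrightarrow> infinitesimal (y - x)"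
  using infinitesimal_minus[of "x - y"] by simp

lemma infinitesimal_trans:
  "infinitesimal (x - y) \<Longrightarrow> infinitesimal (y - z) \<Longrightarrow> infinitesimal (x - z)"
  for x :: "'v::unperforated_group"
  using infinitesimal_add[of "x - y" "y - z"] by simp

lemma infinitesimal_0: "infinitesimal 0"
  using small_0[of 0] by (auto simp: infinitesimal_def)

lemma infinitesimal_image: "positive_op F \<Longrightarrow> infinitesimal x \<Longrightarrow> infinitesimal (F x)"
  by (auto simp: infinitesimal_def intro: small_image)

lemma infinitesimal_image_diff:
  "positive_op F \<Longrightarrow> infinitesimal (x - y) \<Longrightarrow> infinitesimal (F x - F y)"
  using infinitesimal_image[of F "x - y"] by (simp add: additive_op_diff positive_op_additive)

lemma infinitesimalI:
  assumes "negligible d x" "negligible e (- x)"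
  shows "infinitesimal x"
proof -
  have "small (d + e) x"
    using assms[THEN negligible_bound_nonneg]
      negligible_mono[OF assms(1), of x "d + e"] negligible_mono[OF assms(2), of "- x" "d + e"]
    by (simp add: small_def)
  then show ?thesis
    by (auto simp: infinitesimal_def)
qed

section \<open>Quadratic forms in a pair of operators\<close>

text \<open>
  For commuting \<open>A\<close> and \<open>N\<close> this is \<open>((\<nu> A - k N)\<^sup>2 + j A (N - A)) w\<close>: the squared
  distance of \<open>\<nu> A\<close> from \<open>k N\<close>, plus \<open>j\<close> times the variance of a single step of the
  Bernstein weights.
\<close>

definition quad :: "('v::ab_group_add \<Rightarrow> 'v) \<Rightarrow> ('v \<Rightarrow> 'v) \<Rightarrow> int \<Rightarrow> int \<Rightarrow> int \<Rightarrow> 'v \<Rightarrow> 'v"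
  where "quad A N \<nu> j k w =
    (\<nu> * \<nu>) \<star> A (A w) - (2 * \<nu> * k) \<star> N (A w) + (k * k) \<star> N (N w) + j \<star> (N (A w) - A (A w))"

text \<open>
  The two ways in which a failure of \<open>A\<close> and \<open>N\<close> to commute enters a step of the average.
\<close>

definition defect_bound ::
    "('v::ordered_ab_group_add \<Rightarrow> 'v) \<Rightarrow> ('v \<Rightarrow> 'v) \<Rightarrow> 'v \<Rightarrow> 'v \<Rightarrow> bool"
  where "defect_bound A N d w \<longleftrightarrow>
    small d (A (N (A w)) - N (A (A w))) \<and> small d (A (N (N w)) - N (N (A w)))"

lemma quad_add:
  "additive_op A \<Longrightarrow> additive_op N \<Longrightarrow> quad A N \<nu> j k (v + w) = quad A N \<nu> j k v + quad A N \<nu> j k w"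
  by (simp add: quad_def scale_expand operator_expand algebra_simps)

text \<open>
  One step of a random walk that moves from \<open>k\<close> to \<open>k - 1\<close> with weight \<open>A\<close> and stays with
  weight \<open>N - A\<close>: the mean of the squared distances is again such a square, with \<open>\<nu>\<close> increased by one, plus
  the variance \<open>A (N - A)\<close>. The right-hand side vanishes if \<open>A\<close> and \<open>N\<close> commute.
\<close>

lemma quad_step_up:
  assumes "additive_op A" "additive_op N"
  shows "A (quad A N \<nu> j (k - 1) w) + N (quad A N \<nu> j k w) - A (quad A N \<nu> j k w)
      - N (quad A N (\<nu> + 1) (j + 1) k w)
    = (2 * \<nu>) \<star> (A (N (A w)) - N (A (A w))) - (2 * k - 1) \<star> (A (N (N w)) - N (N (A w)))"
  unfolding quad_def
  by (simp only: linear_normalize assms mult_1_left mult_1_right)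

lemma quad_step_down:
  assumes "additive_op A" "additive_op N"
  shows "A (quad A N \<nu> j (k + 1) w) + N (quad A N \<nu> j k w) - A (quad A N \<nu> j k w)
      - N (quad A N (\<nu> - 1) (j + 1) k w)
    = (2 * k + 1) \<star> (A (N (N w)) - N (N (A w))) - (2 * \<nu>) \<star> (A (N (A w)) - N (A (A w)))"
  unfolding quad_def
  by (simp only: linear_normalize assms mult_1_left mult_1_right)

text \<open>
  \<open>A / N\<close> plays the role of a fraction between \<open>0\<close> and \<open>1\<close>; it is never formed, only a factor
  \<open>N\<close> on the left of an inequality is cancelled.
\<close>

locale damping =
  fixes A N :: "'v::unperforated_group \<Rightarrow> 'v"
  assumes A: "positive_op A" and N: "positive_op N"
    and A_le_N: "0 \<le> x \<Longrightarrow> A x \<le> N x"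
    and le_N: "0 \<le> x \<Longrightarrow> x \<le> N x"
    and N_reflects: "0 \<le> N x \<Longrightarrow> 0 \<le> x"
begin

lemma additive [simp]: "additive_op A" "additive_op N"
  using A N by (simp_all add: positive_op_additive)

lemma N_cancel: "negligible d (N x) \<Longrightarrow> negligible d x"
proof -
  have "k \<star> x \<le> d" if "k \<star> N x \<le> d" "0 \<le> d" for k
    using N_reflects[of "d - k \<star> x"] that order_trans[OF that(1) le_N[OF that(2)]]
    by (simp add: additive_op_diff additive_op_scale)
  then show "negligible d (N x) \<Longrightarrow> negligible d x"
    by (simp add: negligible_def)
qed

text \<open>
  Averaging with the weights \<open>A\<close> and \<open>N - A\<close> multiplies the bound \<open>d\<close> by \<open>N\<close>, and cancelling
  \<open>N\<close> restores it. The error of the step also stays below \<open>N d\<close>, so the bound is the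
  same after any number of steps.
\<close>

lemma walk_step:
  assumes x: "negligible d x" and y: "negligible d y"
    and small: "small d (A x + N y - A y - N z)"
  shows "negligible d z"
proof -
  have d: "0 \<le> d"
    using x negligible_bound_nonneg by blast
  have "positive_op (\<lambda>x. N x - A x)"
    by (rule positive_opI) (simp_all add: A_le_N additive_op_add)
  from negligible_image[OF this y] have "negligible (N d - A d) (N y - A y)" .
  from negligible_add[OF negligible_image[OF A x] this]
  have "negligible (N d) (A x + (N y - A y))"
    by simp
  moreover have "negligible (N d) (N z - (A x + (N y - A y)))"
  proof -
    have "N z - (A x + (N y - A y)) = - (A x + N y - A y - N z)"
      by (simp add: algebra_simps)
    then show ?thesis
      using small negligible_mono[OF _ order_refl le_N[OF d]] by (simp only: small_def)
  qed
  ultimately have "negligible (N d) (N z)"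
    by (metis add_diff_cancel_left' add_diff_eq diff_add_cancel negligible_add_same)
  then have "k \<star> N z \<le> N d" if "1 \<le> k" for k
    using that by (simp add: negligible_def)
  then have "k \<star> z \<le> d" if "1 \<le> k" for k
    using that N_reflects[of "d - k \<star> z"] by (simp add: additive_op_diff additive_op_scale)
  then show ?thesis
    using d by (simp add: negligible_def)
qed

text \<open>
  After \<open>n\<close> steps the walk has turned the squares \<open>k\<^sup>2 N\<^sup>2 w\<close>, which are positive because both
  \<open>A\<close> and \<open>N\<close> are, into \<open>((n A - k N)\<^sup>2 + n A (N - A)) w\<close>.
\<close>

lemma quad_nearly_nonneg:
  assumes "0 \<le> d" "0 \<le> w" "defect_bound A N d w"
  shows "negligible d (- quad A N (int n) (int n) k w)"
proof (induction n arbitrary: k)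
  case 0
  have "0 \<le> (k * k) \<star> N (N w)"
    using assms(2) by (intro scale_nonneg positive_op_nonneg[OF N]) simp_all
  then show ?case
    using assms(1) by (intro nonpos_negligible) (simp_all add: quad_def)
next
  case (Suc n)
  have "small d (A (- quad A N (int n) (int n) (k - 1) w) + N (- quad A N (int n) (int n) k w)
      - A (- quad A N (int n) (int n) k w) - N (- quad A N (int n + 1) (int n + 1) k w))"
  proof -
    have "A (- quad A N (int n) (int n) (k - 1) w) + N (- quad A N (int n) (int n) k w)
      - A (- quad A N (int n) (int n) k w) - N (- quad A N (int n + 1) (int n + 1) k w)
      = - (A (quad A N (int n) (int n) (k - 1) w) + N (quad A N (int n) (int n) k w)
        - A (quad A N (int n) (int n) k w) - N (quad A N (int n + 1) (int n + 1) k w))"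
      by (simp add: additive_op_minus[of A] additive_op_minus[of N])
    then show ?thesis
      unfolding quad_step_up[OF additive]
      using assms(3) by (simp only: defect_bound_def small_minus small_diff small_scale)
  qed
  from walk_step[OF Suc.IH Suc.IH this] show ?case
    by (simp add: add.commute)
qed

text \<open>
  The walk in the direction that lowers \<open>\<nu>\<close>. After \<open>n\<close> steps from \<open>\<nu> = n\<close> and \<open>j = n\<close> only
  the variance \<open>2 n A (N - A) w\<close> is left at \<open>k = 0\<close>. Two forms are carried along at once since the
  walk may have to act on two vectors with different parameters.
\<close>

lemma quad_descent:
  assumes "defect_bound A N d v" "defect_bound A N d w"
    and "\<And>k. negligible d (u - quad A N \<mu> i k v - quad A N \<nu> j k w)"
  shows "negligible d (u - quad A N (\<mu> - int n) (i + int n) k v - quad A N (\<nu> - int n) (j + int n) k w)"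
proof (induction n arbitrary: k)
  case 0
  then show ?case
    using assms(3) by simp
next
  case (Suc n)
  let ?p = "\<lambda>k. quad A N (\<mu> - int n) (i + int n) k v"
  let ?p' = "quad A N (\<mu> - int n - 1) (i + int n + 1) k v"
  let ?q = "\<lambda>k. quad A N (\<nu> - int n) (j + int n) k w"
  let ?q' = "quad A N (\<nu> - int n - 1) (j + int n + 1) k w"
  have "A (u - ?p (k + 1) - ?q (k + 1)) + N (u - ?p k - ?q k) - A (u - ?p k - ?q k) - N (u - ?p' - ?q')
      = - (A (?p (k + 1)) + N (?p k) - A (?p k) - N ?p')
        + - (A (?q (k + 1)) + N (?q k) - A (?q k) - N ?q')"
    by (simp add: additive_op_diff[of A] additive_op_diff[of N])
  then have "small d (A (u - ?p (k + 1) - ?q (k + 1)) + N (u - ?p k - ?q k)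
      - A (u - ?p k - ?q k) - N (u - ?p' - ?q'))"
    unfolding quad_step_down[OF additive]
    using assms(1,2) by (simp only: defect_bound_def small_add small_minus small_diff small_scale)
  from walk_step[OF Suc.IH Suc.IH this] show ?case
    by (simp add: algebra_simps)
qed

text \<open>
  With \<open>n = m\<^sup>2\<close> the descent turns the right-hand side into \<open>2 n A (N - A) w + n N\<^sup>2 w \<le> 3 n N\<^sup>2 w\<close>.
  Dividing by \<open>n\<close> leaves \<open>2 m z \<le> 3 N\<^sup>2 w\<close> up to \<open>d\<close>, for every \<open>m\<close>.
\<close>

lemma squeeze:
  assumes "0 \<le> w" "defect_bound A N d w"
    and "\<And>m k. 1 \<le> m \<Longrightarrow> negligible d
      ((2 * m * (m * m)) \<star> z - quad A N (m * m) (m * m) k w - (m * m) \<star> N (N w))"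
  shows "negligible (3 \<star> N (N w) + d) z"
proof -
  have d: "0 \<le> d"
    using assms(3)[of 1] by (simp add: negligible_def)
  have w: "0 \<le> A w" "0 \<le> N (N w)" "N (A w) \<le> N (N w)" "0 \<le> A (A w)"
    using assms(1) A N A_le_N[OF assms(1)] by (simp_all add: positive_op_nonneg positive_op_mono)
  have "m \<star> z \<le> 3 \<star> N (N w) + d" if m: "1 \<le> m" for m
  proof -
    obtain n where n: "int n = m * m"
      using zero_le_imp_eq_int[of "m * m"] by auto
    let ?u = "(2 * m * (m * m)) \<star> z - (m * m) \<star> N (N w)"
    have "negligible d (?u - quad A N 0 0 k 0 - quad A N (m * m) (m * m) k w)" for k
      using assms(3)[OF m, of k] by (simp add: quad_def additive_op_0 algebra_simps)
    moreover have "defect_bound A N d 0"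
      using d by (simp add: defect_bound_def additive_op_0 small_0)
    ultimately have "negligible d (?u - quad A N (0 - int n) (0 + int n) 0 0
        - quad A N (m * m - int n) (m * m + int n) 0 w)"
      using assms(2) by (intro quad_descent)
    then have "negligible d (?u - (2 * (m * m)) \<star> (N (A w) - A (A w)))"
      by (simp add: quad_def n additive_op_0 flip: mult_2)
    then have "?u - (2 * (m * m)) \<star> (N (A w) - A (A w)) \<le> d"
      using negligible_scale_le[of d _ 1] by simp
    moreover have "(2 * (m * m)) \<star> (N (A w) - A (A w)) \<le> (2 * (m * m)) \<star> N (N w)"
      using w by (intro scale_left_mono) (simp_all add: diff_le_eq add_increasing2)
    ultimately have "?u - (2 * (m * m)) \<star> N (N w) \<le> d"
      by (meson diff_left_mono order_trans)
    moreover have "d \<le> (m * m) \<star> d"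
    proof -
      have "1 \<le> m * m"
        using mult_mono[OF m m] m by simp
      from scale_right_mono[OF this d] show ?thesis
        by simp
    qed
    ultimately have "?u - (2 * (m * m)) \<star> N (N w) \<le> (m * m) \<star> d"
      by (rule order_trans)
    then have "(m * m) \<star> (2 * m) \<star> z \<le> (m * m) \<star> (3 \<star> N (N w) + d)"
      using scale_add_left[of "2 * (m * m)" "m * m" "N (N w)"]
      by (simp add: scale_scale scale_add_right algebra_simps)
    moreover have "0 < m * m"
      using m by simp
    ultimately have "2 \<star> m \<star> z \<le> 3 \<star> N (N w) + d"
      by (simp add: scale_scale scale_le_cancel)
    also have "\<dots> \<le> 2 \<star> (3 \<star> N (N w) + d)"
      using w d by (simp add: scale_two scale_nonneg add_increasing2)
    finally show ?thesis
      by (rule scale_le_cancel[rotated]) simp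
  qed
  then show ?thesis
    using w d by (simp add: negligible_def scale_nonneg)
qed

end

section \<open>Localizing operators and almost commuting operators\<close>

definition localizing :: "('v::ordered_ab_group_add \<Rightarrow> 'v) \<Rightarrow> bool"
  where "localizing S \<longleftrightarrow> positive_op S \<and> (\<forall>x. 0 \<le> x + S x \<longrightarrow> 0 \<le> x)"

text \<open>
  Positive vectors suffice in the envelope, where every vector is a difference of two positive ones.
\<close>

definition nearly_commute :: "('v::ordered_ab_group_add \<Rightarrow> 'v) \<Rightarrow> ('v \<Rightarrow> 'v) \<Rightarrow> bool"
  where "nearly_commute F G \<longleftrightarrow> (\<forall>x\<ge>0. infinitesimal (F (G x) - G (F x)))"

lemma nearly_commuteD: "nearly_commute F G \<Longrightarrow> 0 \<le> x \<Longrightarrow> infinitesimal (F (G x) - G (F x))"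
  by (simp add: nearly_commute_def)

lemma nearly_commute_refl: "nearly_commute F F"
  by (simp add: nearly_commute_def infinitesimal_0)

lemma nearly_commute_sym: "nearly_commute F G \<Longrightarrow> nearly_commute G F"
  by (simp add: nearly_commute_def infinitesimal_minus_commute)

lemma localizing_positive: "localizing S \<Longrightarrow> positive_op S"
  by (simp add: localizing_def)

lemma damping_localizing:
  fixes S :: "'v::unperforated_group \<Rightarrow> 'v"
  assumes S: "localizing S" and A: "positive_op A" "\<And>x. 0 \<le> x \<Longrightarrow> A x \<le> S x"
  shows "damping A (\<lambda>x. x + S x)"
proof
  show "positive_op (\<lambda>x. x + S x)"
    using localizing_positive[OF S]
    by (intro positive_opI) (simp_all add: additive_op_add positive_op_additive positive_op_nonneg)
  show "A x \<le> x + S x" if "0 \<le> x" for x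
    using A(2)[OF that] that by (simp add: add_increasing)
  show "x \<le> x + S x" if "0 \<le> x" for x
    using positive_op_nonneg[OF localizing_positive[OF S] that] by simp
  show "0 \<le> x" if "0 \<le> x + S x" for x
    using S that unfolding localizing_def by blast
qed (fact A(1))

text \<open>
  With \<open>N = 1 + S\<close> the hypothesis is \<open>K N u \<ge> (K - 1) u\<close>. Iterating it and cancelling \<open>N\<close> each
  time, as in a geometric series for \<open>1 / (1 + K S)\<close>, gives
  \<open>u \<ge> - ((K - 1) / K)\<^sup>J b\<close> for every \<open>J\<close>. So the large multiples of a localizing operator are
  localizing up to arbitrarily small errors.
\<close>

lemma localizing_scale:
  fixes S :: "'v::unperforated_group \<Rightarrow> 'v"
  assumes S: "localizing S" and K: "1 \<le> K" and u: "0 \<le> u + K \<star> S u" and b: "0 \<le> b" "- b \<le> u"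
    and r: "1 \<le> r"
  shows "0 \<le> r \<star> u + b"
proof -
  interpret damping S "\<lambda>x. x + S x"
    using S by (intro damping_localizing localizing_positive) simp_all
  have iter: "0 \<le> (K ^ J) \<star> u + ((K - 1) ^ J) \<star> b" for J
  proof (induction J)
    case 0
    then show ?case
      using b(2) add_left_mono[of "- b" u b] by (simp add: add.commute)
  next
    case (Suc J)
    let ?c = "(K - 1) ^ J"
    have c: "0 \<le> ?c" "0 \<le> (K - 1) * ?c"
      using K by simp_all
    have "0 \<le> (K - 1) \<star> ((K ^ J) \<star> u + ?c \<star> b) + (K ^ J) \<star> (u + K \<star> S u) + ((K - 1) * ?c) \<star> S b"
      using scale_nonneg[OF _ Suc, of "K - 1"] scale_nonneg[OF _ u, of "K ^ J"]
        scale_nonneg[OF c(2) positive_op_nonneg[OF A b(1)]] K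
      by simp
    also have "\<dots> = (K ^ Suc J \<star> u + (K - 1) ^ Suc J \<star> b) + S (K ^ Suc J \<star> u + (K - 1) ^ Suc J \<star> b)"
      by (simp add: scale_expand operator_expand algebra_simps)
    finally show ?case
      by (rule N_reflects)
  qed
  (* Bernoulli's inequality, in a form that also covers K = 1. *)
  have bern: "(K - 1) ^ J * (K - 1 + int J) \<le> K ^ J * (K - 1)" for J
  proof (induction J)
    case (Suc J)
    have "(K - 1) * ((K - 1) ^ J * (K - 1 + int J)) \<le> (K - 1) * (K ^ J * (K - 1))"
      using Suc K by (intro mult_left_mono) simp_all
    moreover have "(K - 1) ^ J * (K - 1) \<le> K ^ J * (K - 1)"
      using K by (intro mult_right_mono power_mono) simp_all
    ultimately show ?case
      by (simp add: algebra_simps)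
  qed simp
  have "\<exists>J. r * (K - 1) ^ J \<le> K ^ J"
  proof (cases "K = 1")
    case True
    then show ?thesis
      by (intro exI[of _ 1]) simp
  next
    case False
    (* By Bernoulli this many steps shrink the factor to at most 1 / r. *)
    have J: "int (nat (r * (K - 1))) = r * (K - 1)"
      using r K by simp
    let ?J = "nat (r * (K - 1))"
    have "(r * (K - 1) ^ ?J) * (K - 1) \<le> (K - 1) ^ ?J * (K - 1 + int ?J)"
      unfolding J using K mult_nonneg_nonneg[of "(K - 1) ^ ?J" "K - 1"] by (simp add: algebra_simps)
    also note bern[of ?J]
    finally have "r * (K - 1) ^ ?J \<le> K ^ ?J"
      using False K by (simp add: mult_le_cancel_right)
    then show ?thesis ..
  qed
  then obtain J where J: "r * (K - 1) ^ J \<le> K ^ J" ..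
  have "0 \<le> r \<star> ((K ^ J) \<star> u + ((K - 1) ^ J) \<star> b) + (K ^ J - r * (K - 1) ^ J) \<star> b"
    using r J b(1) scale_nonneg[OF _ iter[of J], of r] scale_nonneg[OF _ b(1), of "K ^ J - r * (K - 1) ^ J"]
    by simp
  also have "\<dots> = (K ^ J) \<star> (r \<star> u + b)"
    by (simp add: scale_expand algebra_simps)
  finally show ?thesis
    using K scale_nonneg_cancel[of "K ^ J"] by simp
qed

text \<open>
  Where \<open>S\<close> is not small, \<open>v\<close> is negligible because \<open>S v\<close> is; where \<open>S\<close> is small, \<open>v\<close> is
  small by the second bound, up to the arbitrarily small term \<open>w / r\<close>. Both regions are covered at once by
  estimating \<open>(1 + K S) (r v)\<close> and cancelling \<open>1 + K S\<close> approximately.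
\<close>

lemma negligible_by_localization:
  fixes S :: "'v::unperforated_group \<Rightarrow> 'v"
  assumes S: "localizing S" and d: "negligible d (S v)" and w: "0 \<le> w" "0 \<le> w'"
    and v: "\<And>r. 1 \<le> r \<Longrightarrow> \<exists>K\<ge>1. r \<star> v \<le> w + K \<star> S w'"
  shows "\<exists>e. negligible e v"
proof -
  have d0: "0 \<le> d"
    using d by (rule negligible_bound_nonneg)
  have pos: "positive_op S"
    using S by (rule localizing_positive)
  (* A first bound on v, as needed for the approximate cancellation. *)
  obtain K where K: "1 \<le> K" "1 \<star> v \<le> w + K \<star> S w'"
    using v[of 1] by auto
  define b where "b = w + K \<star> S w'"
  have b: "0 \<le> b" "v \<le> b"
    using K w by (simp_all add: b_def scale_nonneg positive_op_nonneg[OF pos])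
  have "r \<star> v \<le> w + d + w' + b" if r: "1 \<le> r" for r
  proof -
    obtain K where K: "1 \<le> K" "r \<star> v \<le> w + K \<star> S w'"
      using v[OF r] by auto
    define u where "u = w + d + w' - r \<star> v"
    have "r \<star> v + (K * r) \<star> S v \<le> (w + K \<star> S w') + d"
      using K r by (intro add_mono negligible_scale_le[OF d]) simp_all
    moreover have "0 \<le> w' + K \<star> S w + K \<star> S d"
      using K w d0 by (intro add_nonneg_nonneg scale_nonneg positive_op_nonneg[OF pos]) simp_all
    ultimately have "0 \<le> (w' + K \<star> S w + K \<star> S d) + ((w + K \<star> S w') + d - (r \<star> v + (K * r) \<star> S v))"
      by simp
    also have "\<dots> = u + K \<star> S u"
      by (simp add: u_def scale_expand operator_expand positive_op_additive[OF pos] algebra_simps)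
    finally have "0 \<le> u + K \<star> S u" .
    moreover have "- (r \<star> b) \<le> u"
    proof -
      have "r \<star> v \<le> r \<star> b"
        using b r by (simp add: scale_left_mono)
      moreover have "0 \<le> w + d + w'"
        using w d0 by simp
      ultimately show ?thesis
        unfolding u_def by (simp add: diff_conv_add_uminus add_increasing del: add_uminus_conv_diff)
    qed
    moreover have "0 \<le> r \<star> b"
      using b r by (simp add: scale_nonneg)
    ultimately have "0 \<le> r \<star> u + r \<star> b"
      using localizing_scale[OF S K(1)] r by blast
    then have "0 \<le> r \<star> (u + b)"
      by (simp add: scale_add_right)
    then have "0 \<le> u + b"
      using r scale_nonneg_cancel[of r] by simp
    then show ?thesis
      by (simp add: u_def algebra_simps)
  qed
  then have "negligible (w + d + w' + b) v"
    using w d0 b by (simp add: negligible_def)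
  then show ?thesis ..
qed

lemma infinitesimal_common_bound:
  fixes xs :: "'v::unperforated_group list"
  assumes "\<And>x. x \<in> set xs \<Longrightarrow> infinitesimal x"
  shows "\<exists>d\<ge>0. \<forall>x\<in>set xs. small d x"
  using assms
proof (induction xs)
  case Nil
  then show ?case
    by auto
next
  case (Cons y xs)
  then obtain d where d: "0 \<le> d" "\<forall>x\<in>set xs. small d x"
    by auto
  obtain e where e: "0 \<le> e" "small e y"
    using Cons.prems[of y] by (auto elim: infinitesimalE)
  have "\<forall>x\<in>set (y # xs). small (d + e) x"
    using d e small_mono[of e y "d + e"] small_mono[of d _ "d + e"] by simp
  then show ?case
    using d(1) e(1) by (intro exI[of _ "d + e"]) simp
qed

lemma int_le_square: "h \<le> h * h" for h :: int
proof (cases "h \<le> 0")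
  case True
  show ?thesis
    using order_trans[OF True zero_le_square[of h]] .
next
  case False
  then show ?thesis
    using mult_mono[of 1 h h h] by simp
qed

text \<open>
  With \<open>N = 1 + S\<close> and \<open>l = n S - k N\<close> one has \<open>l T N x - N T l x = n (S T x - T S x)\<close>. Both terms on the left
  are controlled by the squares \<open>quad\<close>: the first directly, the second after passing from \<open>T\<close> to \<open>Q\<close>,
  which can be moved past \<open>S\<close>. The estimate holds for all \<open>k\<close>, so that it can be squeezed.
\<close>

lemma dominated_nearly_commutes:
  fixes S :: "'v::unperforated_group \<Rightarrow> 'v"
  assumes S: "localizing S" and Q: "positive_op Q" "nearly_commute Q S"
    and T: "positive_op T" "\<And>x. 0 \<le> x \<Longrightarrow> T x \<le> Q x"
  shows "nearly_commute S T"
  unfolding nearly_commute_def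
proof (intro allI impI)
  fix x :: 'v
  assume x: "0 \<le> x"
  define N where "N = (\<lambda>x. x + S x)"
  interpret damping S N
    unfolding N_def using S by (intro damping_localizing localizing_positive) simp_all
  note pos = positive_op_nonneg[OF A] positive_op_nonneg[OF N] positive_op_nonneg[OF Q(1)]
    positive_op_nonneg[OF T(1)]
  note add = positive_op_additive[OF Q(1)] positive_op_additive[OF T(1)]
  have defect: "defect_bound S N d w" if "0 \<le> d" for d w
    using that by (simp add: defect_bound_def N_def operator_expand small_0)
  have quad_nonneg: "0 \<le> quad S N n n k v" if "0 \<le> v" "0 \<le> n" for n k v
    using negligible_scale_le[OF quad_nearly_nonneg[OF order_refl that(1) defect], of 1 "nat n" k] that
    by simp
  (* Completing the square: the form at (n + h, k + h) is the one at (n, k) minus 2 h times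
     the linear term, up to lower order. Both signs of h are used. *)
  have linear_bound:
    "(2 * h) \<star> (n \<star> S v - k \<star> N v) \<le> quad S N n n k v + n \<star> N v"
    if "0 \<le> v" "n = h * h" for n h k v
  proof -
    have h: "h \<le> h * h" "0 \<le> h * h + h"
      using int_le_square[of h] int_le_square[of "- h"] by simp_all
    have "0 \<le> quad S N (n + h) (n + h) (k + h) v + (h * h - h) \<star> S v"
      using that h pos quad_nonneg[of v "n + h" "k + h"] by (intro add_nonneg_nonneg scale_nonneg) simp_all
    also have "\<dots> = quad S N n n k v + n \<star> N v - (2 * h) \<star> (n \<star> S v - k \<star> N v)"
      unfolding quad_def N_def that(2)
      by (simp only: linear_normalize additive)
    finally show ?thesis
      by simp
  qed
  define z where "z = S (T x) - T (S x)"
  define w where "w = T (N x) + N (Q x)"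
  have w: "0 \<le> w"
    using x pos by (simp add: w_def)
  (* The two errors made in moving Q past S; N, n and k enter only through coefficients. *)
  define f g where "f = N (Q (S (S x)) - S (S (Q x)))" and "g = N (Q (S x) - S (Q x))"
  have "infinitesimal f" "infinitesimal g"
  proof -
    have "infinitesimal (Q (S (S x)) - S (Q (S x)))" "infinitesimal (S (Q (S x)) - S (S (Q x)))"
      using nearly_commuteD[OF Q(2)] x pos by (auto intro: infinitesimal_image_diff[OF A])
    then show "infinitesimal f"
      unfolding f_def by (intro infinitesimal_image[OF N]) (rule infinitesimal_trans)
    show "infinitesimal g"
      unfolding g_def using nearly_commuteD[OF Q(2) x] by (rule infinitesimal_image[OF N])
  qed
  then obtain d where d: "0 \<le> d" "small d f" "small d g"
    using infinitesimal_common_bound[of "[f, g]"] by auto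
  have main: "negligible d ((2 * h * n) \<star> z - quad S N n n k w - n \<star> N (N w))"
    if n: "n = h * h" for n h k
  proof -
    let ?l = "\<lambda>v. n \<star> S v - k \<star> N v"
    let ?Y = "quad S N n n k x + n \<star> N x"
    let ?e = "(n * n - 2 * n * k + k * k) \<star> f + (2 * k * k - 2 * n * k + n + n) \<star> g"
    have n0: "0 \<le> n"
      using n by simp
    have "- ((2 * h) \<star> ?l x) \<le> ?Y"
      using linear_bound[OF x, of n "- h" k] n by (simp add: scale_minus_left)
    then have "T (- ((2 * h) \<star> ?l x)) \<le> T ?Y"
      by (rule positive_op_mono[OF T(1)])
    also have "\<dots> \<le> Q ?Y"
      using x n0 pos by (intro T(2) add_nonneg_nonneg quad_nonneg scale_nonneg) simp_all
    finally have "N (T (- ((2 * h) \<star> ?l x))) \<le> N (Q ?Y)"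
      by (rule positive_op_mono[OF N])
    then have first: "- N (T ((2 * h) \<star> ?l x)) \<le> N (Q ?Y)"
      by (simp only: additive_op_minus additive add)
    have second: "(2 * h) \<star> ?l (T (N x)) \<le> quad S N n n k (T (N x)) + n \<star> N (T (N x))"
      using x pos n by (intro linear_bound) simp_all
    have "(2 * h) \<star> ?l (T (N x)) - N (T ((2 * h) \<star> ?l x))
        \<le> quad S N n n k (T (N x)) + n \<star> N (T (N x)) + N (Q ?Y)"
      using add_mono[OF second first] by (simp only: add_uminus_conv_diff)
    moreover have "(2 * h) \<star> ?l (T (N x)) - N (T ((2 * h) \<star> ?l x)) = (2 * h * n) \<star> z"
      unfolding z_def N_def
      by (simp only: linear_normalize additive add)
    moreover have "N (Q ?Y) = quad S N n n k (N (Q x)) + n \<star> N (N (Q x)) + ?e"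
      unfolding f_def g_def quad_def N_def
      by (simp only: linear_normalize additive add)
    ultimately have upper: "(2 * h * n) \<star> z \<le> quad S N n n k w + n \<star> N w + ?e"
      unfolding w_def quad_add[OF additive]
      by (simp only: additive_op_add[OF additive(2)] scale_add_right ac_simps)
    have "n \<star> N w \<le> n \<star> N (N w)"
      using w n0 pos by (intro scale_left_mono le_N) simp_all
    from order_trans[OF upper add_right_mono[OF add_left_mono[OF this]]]
    have difference: "(2 * h * n) \<star> z - quad S N n n k w - n \<star> N (N w) \<le> ?e"
      by (simp only: diff_le_eq) (simp only: ac_simps)
    have "negligible d ?e"
      using small_add[OF small_scale[OF d(2)] small_scale[OF d(3)]] by (simp add: small_def)
    from this difference order_refl show ?thesis
      by (rule negligible_mono)
  qed
  show "infinitesimal (S (T x) - T (S x))"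
  proof (rule infinitesimalI)
    show "negligible (3 \<star> N (N w) + d) (S (T x) - T (S x))"
      unfolding z_def[symmetric] using main by (intro squeeze[OF w defect[OF d(1)]]) simp
    show "negligible (3 \<star> N (N w) + d) (- (S (T x) - T (S x)))"
      unfolding z_def[symmetric] using main[of _ "- m" for m]
      by (intro squeeze[OF w defect[OF d(1)]]) (simp add: scale_minus_left scale_minus_right)
  qed
qed

lemma nearly_commute_damping:
  fixes F :: "'v::unperforated_group \<Rightarrow> 'v"
  assumes "positive_op F" "nearly_commute F S"
  shows "nearly_commute F (\<lambda>x. x + S x)"
  using assms by (simp add: nearly_commute_def additive_op_add[of F] positive_op_additive)

lemma nearly_commute_square:
  fixes F :: "'v::unperforated_group \<Rightarrow> 'v"
  assumes "positive_op F" "positive_op G" "positive_op H"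
    and "nearly_commute F G" "nearly_commute F H" "0 \<le> x"
  shows "infinitesimal (F (G (H x)) - G (H (F x)))"
proof -
  have "infinitesimal (F (G (H x)) - G (F (H x)))"
    using nearly_commuteD[OF assms(4), of "H x"] positive_op_nonneg[OF assms(3,6)] .
  moreover have "infinitesimal (G (F (H x)) - G (H (F x)))"
    using infinitesimal_image_diff[OF assms(2) nearly_commuteD[OF assms(5,6)]] .
  ultimately show ?thesis
    by (rule infinitesimal_trans)
qed

text \<open>
  With \<open>N = 1 + S\<close> the operator \<open>l = n N A - k N N\<close> satisfies
  \<open>l T x - T l x \<approx> n (N A T x - T N A x)\<close> since \<open>T\<close> almost commutes with \<open>N\<close>. The rest is the estimate of \<open>dominated_nearly_commutes\<close>, where now \<open>A\<close> and \<open>N\<close> commute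
  only up to infinitesimals and squares are positive only up to the bound \<open>d\<close>.
\<close>

lemma nearly_commute_between:
  fixes S :: "'v::unperforated_group \<Rightarrow> 'v"
  assumes S: "localizing S"
    and below: "positive_op A" "\<And>x. 0 \<le> x \<Longrightarrow> A x \<le> S x" "nearly_commute A S"
    and Q: "positive_op Q" "nearly_commute Q A" "nearly_commute Q S"
    and T: "positive_op T" "\<And>x. 0 \<le> x \<Longrightarrow> T x \<le> Q x" "nearly_commute T S"
  shows "nearly_commute A T"
  unfolding nearly_commute_def
proof (intro allI impI)
  fix x :: 'v
  assume x: "0 \<le> x"
  define N where "N = (\<lambda>x. x + S x)"
  interpret damping A N
    unfolding N_def using S below by (intro damping_localizing)
  note pos = positive_op_nonneg[OF below(1)] positive_op_nonneg[OF N] positive_op_nonneg[OF Q(1)]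
    positive_op_nonneg[OF T(1)]
  note add = positive_op_additive[OF Q(1)] positive_op_additive[OF T(1)]
  have AN: "nearly_commute A N" and QN: "nearly_commute Q N" and TN: "nearly_commute T N"
    unfolding N_def using below(1,3) Q T by (simp_all add: nearly_commute_damping)
  have NAA: "infinitesimal (A (N (A v)) - N (A (A v)))"
    and NNA: "infinitesimal (A (N (N v)) - N (N (A v)))" if "0 \<le> v" for v
    using nearly_commuteD[OF AN, of "A v"] nearly_commute_square[OF below(1) N N AN AN, of v] that pos
    by simp_all
  define w where "w = T x + Q x"
  have w: "0 \<le> w"
    using x pos by (simp add: w_def)
  define g1 g2 g3 where "g1 = Q (A (A x)) - A (A (Q x))" and "g2 = Q (N (A x)) - N (A (Q x))"
    and "g3 = Q (N (N x)) - N (N (Q x))"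
  define t where "t = T (N (N x)) - N (N (T x))"
  have g: "infinitesimal g1" "infinitesimal g2" "infinitesimal g3" "infinitesimal t"
    using nearly_commute_square[OF Q(1) below(1) below(1) Q(2) Q(2) x]
      nearly_commute_square[OF Q(1) N below(1) QN Q(2) x]
      nearly_commute_square[OF Q(1) N N QN QN x]
      nearly_commute_square[OF T(1) N N TN TN x]
    by (simp_all only: g1_def g2_def g3_def t_def)
  define es where "es = [A (N (A x)) - N (A (A x)), A (N (N x)) - N (N (A x)),
    A (N (A (T x))) - N (A (A (T x))), A (N (N (T x))) - N (N (A (T x))),
    A (N (A w)) - N (A (A w)), A (N (N w)) - N (N (A w)), g1, g2, g3, t]"
  have "infinitesimal v" if "v \<in> set es" for v
  proof -
    have Tx: "0 \<le> T x"
      using x pos by simp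
    show ?thesis
      using that unfolding es_def list.set insert_iff empty_iff
      by (elim disjE FalseE) (simp_all only: g NAA[OF x] NNA[OF x] NAA[OF Tx] NNA[OF Tx] NAA[OF w] NNA[OF w])
  qed
  then have "\<exists>d\<ge>0. \<forall>v\<in>set es. small d v"
    by (rule infinitesimal_common_bound)
  then obtain d where d: "0 \<le> d" and bound: "\<forall>v\<in>set es. small d v"
    by blast
  have defect: "defect_bound A N d x" "defect_bound A N d (T x)" "defect_bound A N d w"
    and small: "small d g1" "small d g2" "small d g3" "small d t"
    using bound by (simp_all add: es_def defect_bound_def)
  define D where "D = d + Q d"
  have D: "d \<le> D" "Q d \<le> D" "0 \<le> D"
    using d pos by (simp_all add: D_def)
  define z where "z = N (A (T x)) - T (N (A x))"
  have main: "negligible D ((2 * h * n) \<star> z - quad A N n n k w - n \<star> N (N w))"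
    if n: "n = h * h" for n h k
  proof -
    let ?l = "\<lambda>v. n \<star> N (A v) - k \<star> N (N v)"
    let ?Y = "\<lambda>v. quad A N n n k v + n \<star> N (N v)"
    have n0: "0 \<le> n" "int (nat n) = n"
      using n by simp_all
    have quad: "negligible d (- quad A N n n k v)" if "0 \<le> v" "defect_bound A N d v" for k v
      using quad_nearly_nonneg[OF d that, of "nat n" k] n0 by simp
    (* Replacing k by k + h completes the square with the linear term. *)
    have complete_square: "(2 * h) \<star> ?l v - ?Y v = - quad A N n n (k + h) v"
      if "n = h * h" for h v
    proof -
      have "quad A N n n (k + h) v = ?Y v - (2 * h) \<star> ?l v"
        unfolding quad_def that
        by (simp only: scale_expand algebra_simps mult_2 mult_2_right)
      then show ?thesis
        by (simp only: minus_diff_eq)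
    qed
    have first: "negligible d ((2 * h) \<star> ?l (T x) - ?Y (T x))"
      unfolding complete_square[OF n] using x pos defect by (intro quad) simp_all
    have "negligible d (- ((2 * h) \<star> ?l x) - ?Y x)"
      using complete_square[of "- h" x] n quad[OF x defect(1), of "k - h"]
      by (simp add: scale_minus_left)
    from negligible_image[OF T(1) this]
    have second: "negligible (T d) (- T ((2 * h) \<star> ?l x) - T (?Y x))"
      by (simp only: additive_op_diff additive_op_minus add)
    (* The form at x is itself only nearly positive, so replacing T by Q
       costs another negligible term. *)
    have "positive_op (\<lambda>v. Q v - T v)"
      using T(2) by (intro positive_opI) (simp_all add: additive_op_add[OF add(1)] additive_op_add[OF add(2)])
    moreover have "negligible d (- ?Y x)"
      using negligible_mono[OF quad[OF x defect(1), of k] _ order_refl, of "- ?Y x"] x n0 pos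
      by (simp add: scale_nonneg)
    ultimately have "negligible (Q d - T d) (Q (- ?Y x) - T (- ?Y x))"
      by (rule negligible_image)
    then have "negligible (Q d - T d) (T (?Y x) - Q (?Y x))"
      by (simp only: additive_op_minus[OF add(1)] additive_op_minus[OF add(2)] diff_minus_eq_add uminus_add_conv_diff)
    from negligible_add[OF second this]
    have second': "negligible (Q d) (- T ((2 * h) \<star> ?l x) - Q (?Y x))"
      by simp
    let ?e = "(n * n) \<star> g1 - (2 * n * k) \<star> g2 + (k * k) \<star> g3 + n \<star> (g2 - g1) + n \<star> g3"
    let ?t = "(2 * h * k) \<star> t"
    have "small d (?e - ?t)"
      using small by (intro small_add small_diff small_scale)
    then have third: "negligible D (?e - ?t)"
      using small_mono[OF _ D(1)] by (simp add: small_def)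
    have "negligible D ((2 * h) \<star> ?l (T x) - ?Y (T x))"
      using negligible_mono[OF first order_refl D(1)] .
    moreover have "negligible D (- T ((2 * h) \<star> ?l x) - Q (?Y x))"
      using negligible_mono[OF second' order_refl D(2)] .
    ultimately have "negligible D ((2 * h) \<star> ?l (T x) - ?Y (T x)
        + (- T ((2 * h) \<star> ?l x) - Q (?Y x)) + (?e - ?t))"
      using third by (intro negligible_add_same)
    also have "(2 * h) \<star> ?l (T x) - ?Y (T x) + (- T ((2 * h) \<star> ?l x) - Q (?Y x)) + (?e - ?t)
        = (2 * h) \<star> ?l (T x) - T ((2 * h) \<star> ?l x) - ?t - (?Y (T x) + (Q (?Y x) - ?e))"
      by (simp add: algebra_simps)
    also have "Q (?Y x) - ?e = ?Y (Q x)"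
      unfolding g1_def g2_def g3_def quad_def
      by (simp only: linear_normalize additive add)
    also have "(2 * h) \<star> ?l (T x) - T ((2 * h) \<star> ?l x) - ?t = (2 * h * n) \<star> z"
      unfolding z_def t_def
      by (simp only: linear_normalize additive add)
    also have "?Y (T x) + ?Y (Q x) = ?Y w"
      unfolding w_def quad_add[OF additive]
      by (simp only: additive_op_add[OF additive(2)] scale_add_right ac_simps)
    finally show ?thesis
      by (simp only: diff_diff_eq)
  qed
  have defect_D: "defect_bound A N D w"
    using defect(3) D(1) small_mono[OF _ D(1)] by (simp add: defect_bound_def)
  have "infinitesimal z"
  proof (rule infinitesimalI)
    show "negligible (3 \<star> N (N w) + D) z"
      using main by (intro squeeze[OF w defect_D]) simp
    show "negligible (3 \<star> N (N w) + D) (- z)"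
      using main[of _ "- m" for m]
      by (intro squeeze[OF w defect_D]) (simp add: scale_minus_left scale_minus_right)
  qed
  moreover have "infinitesimal (T (N (A x)) - N (T (A x)))"
    using nearly_commuteD[OF TN] x pos by simp
  ultimately have "infinitesimal (N (A (T x)) - N (T (A x)))"
    unfolding z_def by (rule infinitesimal_trans)
  then have "infinitesimal (N (A (T x) - T (A x)))"
    by (simp add: additive_op_diff)
  then obtain e where "negligible e (N (A (T x) - T (A x)))" "negligible e (N (- (A (T x) - T (A x))))"
    unfolding infinitesimal_def small_def additive_op_minus[OF additive(2)] by blast
  then show "infinitesimal (A (T x) - T (A x))"
    using N_cancel infinitesimalI by blast
qed

text \<open>
  Put \<open>y = T S x\<close> and \<open>z = S T x - T S x\<close>. By hypothesis \<open>T\<close> and \<open>S\<close> commute on \<open>S x\<close>, so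
  applying \<open>S T\<close> to the positive vector \<open>((n S - k N)\<^sup>2 + n S) x\<close> gives
  \<open>((n S - k N)\<^sup>2 + n S) y + k\<^sup>2 z \<ge> 0\<close> up to an infinitesimal: only the constant coefficient
  \<open>k\<^sup>2\<close> of the polynomial meets the failure of commutation. Averaging over \<open>k\<close> turns \<open>k\<^sup>2\<close> into
  \<open>n\<^sup>2 S\<^sup>2 + n S\<close> in front of \<open>z\<close> and leaves \<open>2 n S\<close> in front of \<open>N\<^sup>2 y\<close>, so that
  \<open>- S\<^sup>2 z\<close> is negligible. The two factors \<open>S\<close> are then removed one after the other, using
  \<open>- z \<le> y\<close> and that \<open>y\<close> is small where \<open>S\<close> is small.
\<close>

lemma half_commute:
  fixes S :: "'v::unperforated_group \<Rightarrow> 'v"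
  assumes S: "localizing S" and T: "positive_op T" and x: "0 \<le> x"
    and e: "infinitesimal (S (T (S x)) - T (S (S x)))"
  shows "\<exists>d. negligible d (T (S x) - S (T x))"
proof -
  define N where "N = (\<lambda>x. x + S x)"
  interpret damping S N
    unfolding N_def using S by (intro damping_localizing localizing_positive) simp_all
  note pos = positive_op_nonneg[OF A] positive_op_nonneg[OF N] positive_op_nonneg[OF T]
  note add = positive_op_additive[OF T]
  have defect: "defect_bound S N d w" if "0 \<le> d" for d w
    using that by (simp add: defect_bound_def N_def operator_expand small_0)
  have quad_nonneg: "0 \<le> quad S N n n k x" if "0 \<le> n" for n k
    using negligible_scale_le[OF quad_nearly_nonneg[OF order_refl x defect], of 1 "nat n" k] that
    by simp
  define y z where "y = T (S x)" and "z = S (T x) - T (S x)"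
  define e' where "e' = S (T (S x)) - T (S (S x))"
  have y: "0 \<le> y"
    using x pos by (simp add: y_def)
  have z: "- z \<le> y" "z \<le> S (T x)"
    using x pos by (simp_all add: y_def z_def)
  obtain d where d: "0 \<le> d" "small d e'"
    using e by (auto simp: e'_def elim: infinitesimalE)
  define D where "D = N (N (S d))"
  have D: "0 \<le> D" "small D (N (N (S e')))"
    unfolding D_def using d pos small_image[OF N small_image[OF N small_image[OF A d(2)]]] by simp_all
  (* The factor N N makes room for the term with z, which enters as the square with nu = 0:
     k k N N z. *)
  have start: "negligible D (0 - quad S N 0 0 k z - quad S N n n k (N (N y)))" if "0 \<le> n" for n k
  proof -
    have "0 \<le> N (N (S (T (quad S N n n k x))))"
      using pos quad_nonneg[OF that] by simp
    also have "N (N (S (T (quad S N n n k x))))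
        = quad S N 0 0 k z + quad S N n n k (N (N y)) - (n * n - 2 * n * k + k * k) \<star> N (N (S e'))"
      unfolding quad_def N_def y_def z_def e'_def
      by (simp only: linear_normalize additive add
          mult_zero_left mult_zero_right)
    finally have "0 - quad S N 0 0 k z - quad S N n n k (N (N y))
        \<le> - ((n * n - 2 * n * k + k * k) \<star> N (N (S e')))"
      by (simp add: algebra_simps)
    moreover have "negligible D (- ((n * n - 2 * n * k + k * k) \<star> N (N (S e'))))"
      using small_scale[OF D(2)] by (simp add: small_def)
    ultimately show ?thesis
      using negligible_mono[OF _ _ order_refl] by blast
  qed
  have "n \<star> S (S (- z)) \<le> S (S (T x)) + 2 \<star> S (N (N y)) + D" if n: "1 \<le> n" for n
  proof -
    have "negligible D (0 - quad S N (0 - int (nat n)) (0 + int (nat n)) 0 z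
        - quad S N (n - int (nat n)) (n + int (nat n)) 0 (N (N y)))"
      using start n D(1) by (intro quad_descent defect) simp_all
    then have "0 - quad S N (- n) n 0 z - quad S N 0 (n + n) 0 (N (N y)) \<le> D"
      using n negligible_scale_le[of D _ 1] by simp
    moreover have "quad S N (- n) n 0 z = n \<star> S z - (n * n) \<star> S (S (- z))"
      by (simp add: quad_def N_def scale_expand operator_expand algebra_simps)
    moreover have "quad S N 0 (n + n) 0 (N (N y)) = n \<star> 2 \<star> S (N (N y))"
      by (simp add: quad_def N_def scale_scale mult.commute)
    moreover have "n \<star> S z \<le> n \<star> S (S (T x))"
      using n z by (intro scale_left_mono positive_op_mono[OF A]) simp_all
    moreover have "D \<le> n \<star> D"
      using scale_right_mono[OF n D(1)] by simp
    ultimately have descent: "0 - (n \<star> S z - (n * n) \<star> S (S (- z))) - n \<star> 2 \<star> S (N (N y)) \<le> D"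
        "n \<star> S z \<le> n \<star> S (S (T x))" "D \<le> n \<star> D"
      by simp_all
    have "(n * n) \<star> S (S (- z))
        = 0 - (n \<star> S z - (n * n) \<star> S (S (- z))) - n \<star> 2 \<star> S (N (N y))
          + n \<star> S z + n \<star> 2 \<star> S (N (N y))"
      by simp
    also have "\<dots> \<le> n \<star> D + n \<star> S (S (T x)) + n \<star> 2 \<star> S (N (N y))"
      using descent by (intro add_mono order_refl) (rule order_trans)
    also have "\<dots> = n \<star> S (S (T x)) + n \<star> 2 \<star> S (N (N y)) + n \<star> D"
      by (simp only: ac_simps)
    finally have "n \<star> n \<star> S (S (- z)) \<le> n \<star> (S (S (T x)) + 2 \<star> S (N (N y)) + D)"
      by (simp only: scale_scale scale_add_right)
    then show ?thesis
      using n scale_le_cancel[of n] by simp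
  qed
  then have "negligible (S (S (T x)) + 2 \<star> S (N (N y)) + D) (S (S (- z)))"
    using x y D pos by (simp add: negligible_def scale_nonneg)
  moreover have "\<exists>K\<ge>1. r \<star> S (- z) \<le> 0 + K \<star> S y" if "1 \<le> r" for r
    using that z by (intro exI[of _ r]) (simp add: scale_left_mono positive_op_mono[OF A])
  ultimately obtain d' where d': "negligible d' (S (- z))"
    using negligible_by_localization[OF S, of _ "S (- z)" 0 y] y by blast
  have "\<exists>K\<ge>1. r \<star> - z \<le> (T x + d) + K \<star> S y" if r: "1 \<le> r" for r
  proof -
    let ?K = "(r + 1) * (r + 1)"
    (* This choice of parameters gives exactly r S x \<le> x + (r + 1)^2 S S x, the estimate
       showing that T S x is small where S is small. *)
    have "0 \<le> quad S N (r + 2) (r + 2) 1 x"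
      using r by (intro quad_nonneg) simp
    also have "\<dots> = x + ?K \<star> S (S x) - r \<star> S x"
      unfolding quad_def N_def
      by (simp only: linear_normalize additive
          mult_1_left mult_1_right)
    finally have "r \<star> S x \<le> x + ?K \<star> S (S x)"
      by simp
    from positive_op_mono[OF T this] have "r \<star> y \<le> T x + ?K \<star> T (S (S x))"
      by (simp only: y_def operator_expand add)
    also have "\<dots> = T x + ?K \<star> - e' + ?K \<star> S y"
      by (simp add: e'_def y_def scale_diff_right scale_minus_right)
    also have "\<dots> \<le> T x + d + ?K \<star> S y"
      using negligible_scale_le[of d "- e'" ?K] d(2) r by (simp add: small_def)
    finally have "r \<star> y \<le> T x + d + ?K \<star> S y" .
    moreover have "r \<star> - z \<le> r \<star> y"
      using z r by (intro scale_left_mono) simp_all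
    moreover have "1 \<le> ?K"
      using r mult_mono[of 1 "r + 1" 1 "r + 1"] by simp
    ultimately show ?thesis
      by (meson order_trans)
  qed
  then obtain d'' where "negligible d'' (- z)"
    using negligible_by_localization[OF S d', of "T x + d" y] x y d pos by auto
  then show ?thesis
    by (auto simp: z_def)
qed

section \<open>Products with localizable elements\<close>

text \<open>
  The structure that the envelope carries. It is invariant under exchanging the factors of the product.
\<close>

locale localizable_product =
  fixes mul :: "'v::unperforated_group \<Rightarrow> 'v \<Rightarrow> 'v"  (infixl \<open>\<bullet>\<close> 70)
  assumes mul_add_left: "(a + b) \<bullet> c = a \<bullet> c + b \<bullet> c"
    and mul_add_right: "a \<bullet> (b + c) = a \<bullet> b + a \<bullet> c"
    and mul_nonneg: "0 \<le> a \<Longrightarrow> 0 \<le> b \<Longrightarrow> 0 \<le> a \<bullet> b"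
    and localizable_above:
      "0 \<le> a \<Longrightarrow> \<exists>s\<ge>a. localizing (\<lambda>x. s \<bullet> x) \<and> localizing (\<lambda>x. x \<bullet> s)"
begin

lemma opposite_product: "localizable_product (\<lambda>a b. b \<bullet> a)"
proof
  show "\<exists>s\<ge>a. localizing (\<lambda>x. x \<bullet> s) \<and> localizing (\<lambda>x. s \<bullet> x)" if "0 \<le> a" for a
    using localizable_above[OF that] by blast
qed (simp_all add: mul_add_left mul_add_right mul_nonneg)

lemma positive_left: "0 \<le> a \<Longrightarrow> positive_op (\<lambda>x. a \<bullet> x)"
  by (simp add: positive_opI mul_add_right mul_nonneg)

lemma positive_right: "0 \<le> a \<Longrightarrow> positive_op (\<lambda>x. x \<bullet> a)"
  by (simp add: positive_opI mul_add_left mul_nonneg)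

lemma mul_left_mono: "a \<le> b \<Longrightarrow> 0 \<le> x \<Longrightarrow> a \<bullet> x \<le> b \<bullet> x"
  by (rule positive_op_mono[OF positive_right])

lemma mul_right_mono: "a \<le> b \<Longrightarrow> 0 \<le> x \<Longrightarrow> x \<bullet> a \<le> x \<bullet> b"
  by (rule positive_op_mono[OF positive_left])

text \<open>
  Take a localizable \<open>s \<ge> a + b\<close>. Each of \<open>L\<^sub>a\<close> and \<open>L\<^sub>b\<close> is dominated by \<open>L\<^sub>s\<close>, which
  commutes with itself; so both almost commute with \<open>L\<^sub>s\<close>, and then with each other.
\<close>

lemma left_nearly_commute:
  assumes "0 \<le> a" "0 \<le> b"
  shows "nearly_commute (\<lambda>x. a \<bullet> x) (\<lambda>x. b \<bullet> x)"
proof -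
  obtain s where s: "a + b \<le> s" "localizing (\<lambda>x. s \<bullet> x)"
    using localizable_above[of "a + b"] assms by auto
  have below: "a \<le> s" "b \<le> s"
    using s(1) assms order_trans[of a "a + b" s] order_trans[of b "a + b" s] by simp_all
  note pos = localizing_positive[OF s(2)]
  have "nearly_commute (\<lambda>x. s \<bullet> x) (\<lambda>x. c \<bullet> x)" if "0 \<le> c" "c \<le> s" for c
    by (rule dominated_nearly_commutes[where S = "\<lambda>x. s \<bullet> x" and Q = "\<lambda>x. s \<bullet> x"
          and T = "\<lambda>x. c \<bullet> x", OF s(2) pos nearly_commute_refl positive_left[OF that(1)]
          mul_left_mono[OF that(2)]])
  note comm = this[OF assms(1) below(1)] this[OF assms(2) below(2)]
  show ?thesis
    by (rule nearly_commute_between[where S = "\<lambda>x. s \<bullet> x" and Q = "\<lambda>x. s \<bullet> x"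
          and A = "\<lambda>x. a \<bullet> x" and T = "\<lambda>x. b \<bullet> x",
          OF s(2) positive_left[OF assms(1)] mul_left_mono[OF below(1)] nearly_commute_sym[OF comm(1)]
          pos comm(1) nearly_commute_refl positive_left[OF assms(2)] mul_left_mono[OF below(2)]
          nearly_commute_sym[OF comm(2)]])
qed

lemma right_nearly_commute:
  "0 \<le> a \<Longrightarrow> 0 \<le> b \<Longrightarrow> nearly_commute (\<lambda>x. x \<bullet> a) (\<lambda>x. x \<bullet> b)"
  by (rule localizable_product.left_nearly_commute[OF opposite_product])

text \<open>
  The multiplications \<open>L\<^sub>s\<close> and \<open>R\<^sub>t\<close> almost commute on \<open>s x\<close>, because
  \<open>s ((s x) t) \<approx> s ((s t) x) \<approx> (s t) (s x) \<approx> (s (s x)) t\<close> only exchanges left factors with left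
  factors and right factors with right factors.
\<close>

lemma associator_half_negligible:
  assumes s: "0 \<le> s" "localizing (\<lambda>x. s \<bullet> x)" and "0 \<le> t" "0 \<le> x"
  shows "\<exists>d. negligible d ((s \<bullet> x) \<bullet> t - s \<bullet> (x \<bullet> t))"
proof -
  have pos: "0 \<le> s \<bullet> x" "0 \<le> s \<bullet> t"
    using assms by (simp_all add: mul_nonneg)
  have "infinitesimal (s \<bullet> ((s \<bullet> x) \<bullet> t) - s \<bullet> ((s \<bullet> t) \<bullet> x))"
    by (rule infinitesimal_image_diff[OF positive_left[OF s(1)]
        nearly_commuteD[OF right_nearly_commute[OF assms(3,4)] s(1)]])
  moreover have "infinitesimal (s \<bullet> ((s \<bullet> t) \<bullet> x) - (s \<bullet> t) \<bullet> (s \<bullet> x))"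
    by (rule nearly_commuteD[OF left_nearly_commute[OF s(1) pos(2)] assms(4)])
  moreover have "infinitesimal ((s \<bullet> t) \<bullet> (s \<bullet> x) - (s \<bullet> (s \<bullet> x)) \<bullet> t)"
    by (rule nearly_commuteD[OF right_nearly_commute[OF pos(1) assms(3)] s(1)])
  ultimately have "infinitesimal (s \<bullet> ((s \<bullet> x) \<bullet> t) - (s \<bullet> (s \<bullet> x)) \<bullet> t)"
    by (blast intro: infinitesimal_trans)
  from half_commute[OF s(2) positive_right[OF \<open>0 \<le> t\<close>] \<open>0 \<le> x\<close> this] show ?thesis .
qed

lemma localizing_nearly_associate:
  assumes "0 \<le> s" "localizing (\<lambda>x. s \<bullet> x)" "0 \<le> t" "localizing (\<lambda>x. x \<bullet> t)"
  shows "nearly_commute (\<lambda>x. s \<bullet> x) (\<lambda>x. x \<bullet> t)"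
  unfolding nearly_commute_def
proof (intro allI impI)
  fix x :: 'v
  assume x: "0 \<le> x"
  obtain d where "negligible d ((s \<bullet> x) \<bullet> t - s \<bullet> (x \<bullet> t))"
    using associator_half_negligible[OF assms(1-3) x] ..
  moreover obtain e where "negligible e (s \<bullet> (x \<bullet> t) - (s \<bullet> x) \<bullet> t)"
    using localizable_product.associator_half_negligible[OF opposite_product assms(3,4,1) x] ..
  ultimately show "infinitesimal (s \<bullet> (x \<bullet> t) - (s \<bullet> x) \<bullet> t)"
    by (intro infinitesimalI[of e _ d]) simp_all
qed

text \<open>
  \<open>R\<^sub>c\<close> is dominated by \<open>R\<^sub>t\<close> for a localizable \<open>t \<ge> c\<close>, and \<open>R\<^sub>t\<close> is now known to
  almost commute with \<open>L\<^sub>s\<close>.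
\<close>

lemma localizing_left_nearly_associates:
  assumes "0 \<le> s" "localizing (\<lambda>x. s \<bullet> x)" "0 \<le> c"
  shows "nearly_commute (\<lambda>x. s \<bullet> x) (\<lambda>x. x \<bullet> c)"
proof -
  obtain t where t: "c \<le> t" "localizing (\<lambda>x. x \<bullet> t)"
    using localizable_above[OF assms(3)] by blast
  then have "0 \<le> t"
    using assms(3) by simp
  then have "nearly_commute (\<lambda>x. x \<bullet> t) (\<lambda>x. s \<bullet> x)"
    by (intro nearly_commute_sym[OF localizing_nearly_associate[OF assms(1,2) _ t(2)]])
  from dominated_nearly_commutes[where S = "\<lambda>x. s \<bullet> x" and Q = "\<lambda>x. x \<bullet> t"
      and T = "\<lambda>x. x \<bullet> c", OF assms(2) positive_right[OF \<open>0 \<le> t\<close>] this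
      positive_right[OF assms(3)] mul_right_mono[OF t(1)]]
  show ?thesis .
qed

lemma nearly_associative:
  assumes "0 \<le> a" "0 \<le> c"
  shows "nearly_commute (\<lambda>x. a \<bullet> x) (\<lambda>x. x \<bullet> c)"
proof -
  obtain s where s: "a \<le> s" "localizing (\<lambda>x. s \<bullet> x)"
    using localizable_above[OF assms(1)] by blast
  obtain t where t: "c \<le> t" "localizing (\<lambda>x. x \<bullet> t)"
    using localizable_above[OF assms(2)] by blast
  have st: "0 \<le> s" "0 \<le> t"
    using s t assms by simp_all
  have ta: "nearly_commute (\<lambda>x. x \<bullet> t) (\<lambda>x. a \<bullet> x)"
    by (rule localizable_product.localizing_left_nearly_associates[OF opposite_product st(2) t(2) assms(1)])
  note ts = nearly_commute_sym[OF localizing_left_nearly_associates[OF st(1) s(2) st(2)]]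
    and cs = nearly_commute_sym[OF localizing_left_nearly_associates[OF st(1) s(2) assms(2)]]
  show ?thesis
    by (rule nearly_commute_between[where S = "\<lambda>x. s \<bullet> x" and Q = "\<lambda>x. x \<bullet> t"
          and A = "\<lambda>x. a \<bullet> x" and T = "\<lambda>x. x \<bullet> c",
          OF s(2) positive_left[OF assms(1)] mul_left_mono[OF s(1)]
          left_nearly_commute[OF assms(1) st(1)] positive_right[OF st(2)] ta ts
          positive_right[OF assms(2)] mul_right_mono[OF t(1)] cs])
qed

lemma associator_infinitesimal:
  assumes "0 \<le> a" "0 \<le> b" "0 \<le> c"
  shows "infinitesimal ((a \<bullet> b) \<bullet> c - a \<bullet> (b \<bullet> c))"
  by (rule infinitesimal_minus_commute[OF nearly_commuteD[OF nearly_associative[OF assms(1,3)] assms(2)]])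

text \<open>
  Associativity moves the commutator to the left of a localizable \<open>s\<close>, where left multiplications
  almost commute; so its product with \<open>s\<close> is infinitesimal. It is also at most \<open>a s\<close>, that is, small where
  right multiplication by \<open>s\<close> is small.
\<close>

lemma commutator_half_negligible:
  assumes "0 \<le> a" "0 \<le> b"
  shows "\<exists>d. negligible d (a \<bullet> b - b \<bullet> a)"
proof -
  obtain s where s: "a + b \<le> s" "localizing (\<lambda>x. x \<bullet> s)"
    using localizable_above[of "a + b"] assms by auto
  have bs: "b \<le> s" "0 \<le> s"
    using s(1) assms order_trans[of b "a + b" s] order_trans[of 0 "a + b" s] by simp_all
  note as = associator_infinitesimal[OF assms bs(2)]
    and bs' = associator_infinitesimal[OF assms(2,1) bs(2)]
    and ab = nearly_commuteD[OF left_nearly_commute[OF assms] bs(2)]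
  have "infinitesimal ((a \<bullet> b) \<bullet> s - (b \<bullet> a) \<bullet> s)"
    by (rule infinitesimal_trans[OF infinitesimal_trans[OF as ab] infinitesimal_minus_commute[OF bs']])
  then obtain d where d: "negligible d ((a \<bullet> b - b \<bullet> a) \<bullet> s)"
    unfolding additive_op_diff[OF positive_op_additive[OF positive_right[OF bs(2)]]]
      infinitesimal_def small_def by blast
  have "a \<bullet> b - b \<bullet> a \<le> a \<bullet> b"
    using assms by (simp add: mul_nonneg)
  also have "\<dots> \<le> a \<bullet> s"
    using assms bs by (simp add: mul_right_mono)
  finally have "r \<star> (a \<bullet> b - b \<bullet> a) \<le> 0 + r \<star> (a \<bullet> s)" if "1 \<le> r" for r
    using that by (simp add: scale_left_mono)
  then show ?thesis
    using negligible_by_localization[OF s(2) d order_refl assms(1)] by blast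
qed

lemma commutator_infinitesimal:
  assumes "0 \<le> a" "0 \<le> b"
  shows "infinitesimal (a \<bullet> b - b \<bullet> a)"
proof -
  obtain d e where "negligible d (a \<bullet> b - b \<bullet> a)" "negligible e (b \<bullet> a - a \<bullet> b)"
    using commutator_half_negligible assms by blast
  then show ?thesis
    by (intro infinitesimalI[of d _ e]) simp_all
qed

end

section \<open>The envelope of a commutative monoid\<close>

lemma qle_refl: "a \<lesssim> a"
  unfolding qle_def by (intro exI[of _ 0] exI[of _ 1]) simp

lemma qle_nonneg: "0 \<lesssim> a"
  unfolding qle_def by (intro exI[of _ a] exI[of _ 0] exI[of _ 1]) (simp add: nmult_def)

lemma qle_trans:
  assumes "a \<lesssim> b" "b \<lesssim> e"
  shows "a \<lesssim> e"
proof -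
  obtain c t k where 1: "1 \<le> k" "k \<cdot> a + c + t = k \<cdot> b + t"
    using assms(1) unfolding qle_def by blast
  obtain c' t' k' where 2: "1 \<le> k'" "k' \<cdot> b + c' + t' = k' \<cdot> e + t'"
    using assms(2) unfolding qle_def by blast
  have "(k' * k) \<cdot> a + (k' \<cdot> c + k \<cdot> c') + (k' \<cdot> t + k \<cdot> t' + (k' * k) \<cdot> b)
      = k' \<cdot> (k \<cdot> a + c + t) + k \<cdot> (k' \<cdot> b + c' + t')"
    by (simp add: nmult_add_right nmult_nmult ac_simps)
  also have "\<dots> = (k' * k) \<cdot> e + (k' \<cdot> t + k \<cdot> t' + (k' * k) \<cdot> b)"
    unfolding 1(2) 2(2) by (simp add: nmult_add_right nmult_nmult ac_simps)
  finally show ?thesis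
    unfolding qle_def using mult_le_mono[OF 2(1) 1(1)] by (metis mult_1)
qed

lemma qle_add_mono:
  assumes "a \<lesssim> b"
  shows "a + x \<lesssim> b + x"
proof -
  obtain c t k where k: "1 \<le> k" "k \<cdot> a + c + t = k \<cdot> b + t"
    using assms unfolding qle_def by blast
  have "k \<cdot> (a + x) + c + t = (k \<cdot> a + c + t) + k \<cdot> x"
    by (simp add: nmult_add_right ac_simps)
  also have "\<dots> = k \<cdot> (b + x) + t"
    unfolding k(2) by (simp add: nmult_add_right ac_simps)
  finally show ?thesis
    unfolding qle_def using k(1) by blast
qed

lemma qle_add_cancel:
  assumes "a + x \<lesssim> b + x"
  shows "a \<lesssim> b"
proof -
  obtain c t k where k: "1 \<le> k" "k \<cdot> (a + x) + c + t = k \<cdot> (b + x) + t"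
    using assms unfolding qle_def by blast
  then have "k \<cdot> a + c + (t + k \<cdot> x) = k \<cdot> b + (t + k \<cdot> x)"
    by (simp add: nmult_add_right ac_simps)
  then show ?thesis
    unfolding qle_def using k(1) by blast
qed

lemma qle_nmult_cancel:
  assumes "1 \<le> l" "l \<cdot> a \<lesssim> l \<cdot> b"
  shows "a \<lesssim> b"
proof -
  obtain c t k where k: "1 \<le> k" "k \<cdot> l \<cdot> a + c + t = k \<cdot> l \<cdot> b + t"
    using assms(2) unfolding qle_def by blast
  then show ?thesis
    unfolding qle_def nmult_nmult using mult_le_mono[OF k(1) assms(1)] by (metis mult_1)
qed

lemma qle_add: "a \<lesssim> b \<Longrightarrow> c \<lesssim> d \<Longrightarrow> a + c \<lesssim> b + d"
  by (metis add.commute qle_add_mono qle_trans)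

lemma qle_image:
  assumes "additive_map \<Phi>" "a \<lesssim> b"
  shows "\<Phi> a \<lesssim> \<Phi> b"
proof -
  have mult: "\<Phi> (k \<cdot> x) = k \<cdot> \<Phi> x" if "1 \<le> k" for k x
    using that
  proof (induction k rule: dec_induct)
    case (step k)
    then show ?case
      using assms(1) by (simp add: additive_map_def)
  qed simp
  obtain c t k where k: "1 \<le> k" "k \<cdot> a + c + t = k \<cdot> b + t"
    using assms(2) unfolding qle_def by blast
  then have "\<Phi> (k \<cdot> a + c + t) = \<Phi> (k \<cdot> b + t)"
    by simp
  then have "k \<cdot> \<Phi> a + \<Phi> c + \<Phi> t = k \<cdot> \<Phi> b + \<Phi> t"
    using assms(1) mult[OF k(1)] by (simp add: additive_map_def)
  then show ?thesis
    unfolding qle_def using k(1) by blast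
qed

text \<open>
  Transitivity of the order of differences: \<open>a - b \<le> c - d\<close> and \<open>c - d \<le> e - f\<close>.
\<close>

lemma qle_difference_trans:
  assumes "a + d \<lesssim> c + b" "c + f \<lesssim> e + d"
  shows "a + f \<lesssim> e + b"
proof (rule qle_add_cancel)
  have "(a + d) + f \<lesssim> (c + b) + f"
    using assms(1) by (rule qle_add_mono)
  moreover have "(c + f) + b \<lesssim> (e + d) + b"
    using assms(2) by (rule qle_add_mono)
  ultimately show "(a + f) + d \<lesssim> (e + b) + d"
    using qle_trans[of "a + d + f" "c + f + b" "e + d + b"] by (simp add: ac_simps)
qed

text \<open>
  A pair \<open>(a, b)\<close> stands for \<open>a - b\<close>. Differences are identified as soon as each is below the other,
  which makes the order antisymmetric; the ordinary group of differences would only be quasi-ordered.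
\<close>

quotient_type (overloaded) 'a envelope = "'a::comm_monoid_add \<times> 'a" /
    "\<lambda>(a, b) (c, d). a + d \<lesssim> c + b \<and> c + b \<lesssim> a + d"
proof (rule equivpI)
  show "reflp (\<lambda>(a, b) (c, d). a + d \<lesssim> c + b \<and> c + b \<lesssim> (a::'a) + d)"
    by (auto simp: reflp_def qle_refl)
  show "symp (\<lambda>(a, b) (c, d). a + d \<lesssim> c + b \<and> c + b \<lesssim> (a::'a) + d)"
    by (auto simp: symp_def)
  show "transp (\<lambda>(a, b) (c, d). a + d \<lesssim> c + b \<and> c + b \<lesssim> (a::'a) + d)"
    unfolding transp_def by clarsimp (blast intro: qle_difference_trans)
qed

lift_definition difference :: "'a::comm_monoid_add \<Rightarrow> 'a \<Rightarrow> 'a envelope" is Pair .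

lemma difference_cases: obtains a b where "x = difference a b"
proof -
  have "\<exists>a b. x = difference a b"
    by (induct x rule: envelope.abs_induct) (metis difference.abs_eq surj_pair)
  then show thesis
    using that by blast
qed

lemma difference_eq: "difference a b = difference c d \<longleftrightarrow> a + d \<lesssim> c + b \<and> c + b \<lesssim> a + d"
  by transfer simp

instantiation envelope :: (comm_monoid_add) ordered_ab_group_add
begin

lift_definition zero_envelope :: "'a envelope" is "(0, 0)" .

lift_definition plus_envelope :: "'a envelope \<Rightarrow> 'a envelope \<Rightarrow> 'a envelope"
  is "\<lambda>(a, b) (c, d). (a + c, b + d)"
proof (clarify, intro conjI)
  fix a b a' b' c d c' d' :: 'a
  assume le: "a + b' \<lesssim> a' + b" "a' + b \<lesssim> a + b'" "c + d' \<lesssim> c' + d" "c' + d \<lesssim> c + d'"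
  show "a + c + (b' + d') \<lesssim> a' + c' + (b + d)"
    using qle_add[OF le(1,3)] by (simp add: ac_simps)
  show "a' + c' + (b + d) \<lesssim> a + c + (b' + d')"
    using qle_add[OF le(2,4)] by (simp add: ac_simps)
qed

lift_definition uminus_envelope :: "'a envelope \<Rightarrow> 'a envelope" is "\<lambda>(a, b). (b, a)"
  by (auto simp: add.commute)

definition minus_envelope :: "'a envelope \<Rightarrow> 'a envelope \<Rightarrow> 'a envelope"
  where "minus_envelope x y = x + - y"

lift_definition less_eq_envelope :: "'a envelope \<Rightarrow> 'a envelope \<Rightarrow> bool"
  is "\<lambda>(a, b) (c, d). a + d \<lesssim> c + b"
  by clarify (blast intro: qle_difference_trans)

definition less_envelope :: "'a envelope \<Rightarrow> 'a envelope \<Rightarrow> bool"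
  where "less_envelope x y \<longleftrightarrow> x \<le> y \<and> \<not> y \<le> x"

lemma difference_le: "difference a b \<le> difference c d \<longleftrightarrow> a + d \<lesssim> c + b"
  by transfer simp

lemma difference_add: "difference a b + difference c d = difference (a + c) (b + d)"
  by transfer (simp add: qle_refl)

lemma difference_minus: "- difference a b = difference b a"
  by transfer (simp add: qle_refl)

lemma difference_zero: "(0 :: 'a envelope) = difference 0 0"
  by (simp only: zero_envelope.abs_eq difference.abs_eq)

instance
proof
  fix x y z :: "'a envelope"
  obtain a b where x: "x = difference a b" by (rule difference_cases)
  obtain c d where y: "y = difference c d" by (rule difference_cases)
  obtain e f where z: "z = difference e f" by (rule difference_cases)
  show "x + y + z = x + (y + z)"
    unfolding x y z difference_add by (simp only: add.assoc)
  show "x + y = y + x"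
    unfolding x y difference_add by (simp only: add.commute)
  show "0 + x = x"
    unfolding x difference_zero difference_add by (simp only: add_0)
  show "- x + x = 0"
    unfolding x difference_minus difference_add difference_zero difference_eq
    by (simp add: qle_refl add.commute)
  show "x - y = x + - y"
    by (fact minus_envelope_def)
  show "x < y \<longleftrightarrow> x \<le> y \<and> \<not> y \<le> x"
    by (fact less_envelope_def)
  show "x \<le> x"
    unfolding x difference_le by (rule qle_refl)
  show "x \<le> z" if "x \<le> y" "y \<le> z"
    using that unfolding x y z difference_le by (rule qle_difference_trans)
  show "x = y" if "x \<le> y" "y \<le> x"
    using that unfolding x y difference_le difference_eq by (rule conjI)
  show "z + x \<le> z + y" if "x \<le> y"
    using that qle_add_mono[of "a + d" "c + b" "e + f"]
    unfolding x y z difference_le difference_add by (simp add: ac_simps)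
qed

end

lemma difference_nmult: "k \<cdot> difference a b = difference (k \<cdot> a) (k \<cdot> b)"
  by (induction k) (simp_all add: difference_zero difference_add)

instance envelope :: (comm_monoid_add) unperforated_group
proof
  fix k :: nat and x :: "'a envelope"
  obtain a b where x: "x = difference a b" by (rule difference_cases)
  show "0 \<le> x" if "1 \<le> k" "0 \<le> (\<Sum>i<k. x)"
    using that qle_nmult_cancel[of k b a]
    by (simp add: x difference_zero difference_le difference_nmult flip: nmult_def)
qed

definition envelope_of :: "'a::comm_monoid_add \<Rightarrow> 'a envelope"
  where "envelope_of a = difference a 0"

lemma envelope_of_add: "envelope_of (a + b) = envelope_of a + envelope_of b"
  by (simp add: envelope_of_def difference_add)

lemma envelope_of_nmult: "envelope_of (k \<cdot> a) = k \<cdot> envelope_of a"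
  by (simp add: envelope_of_def difference_nmult) (simp add: nmult_def)

lemma envelope_of_le: "envelope_of a \<le> envelope_of b \<longleftrightarrow> a \<lesssim> b"
  by (simp add: envelope_of_def difference_le)

lemma envelope_of_nonneg: "0 \<le> envelope_of a"
  by (simp add: envelope_of_def difference_zero difference_le qle_nonneg)

lemma difference_envelope_of: "difference a b = envelope_of a - envelope_of b"
  by (simp add: envelope_of_def minus_envelope_def difference_minus difference_add)

lemma envelope_cases: obtains a b where "x = envelope_of a - envelope_of b"
  using difference_cases difference_envelope_of by metis

text \<open>
  A positive element need not come from the monoid, but the definition of the quasi-order shows that one
  of its multiples does.
\<close>

lemma nonneg_multiple_envelope_of:
  assumes "0 \<le> x"
  obtains k c where "1 \<le> k" "k \<cdot> x = envelope_of c"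
proof -
  obtain a b where x: "x = difference a b" by (rule difference_cases)
  then obtain c t k where k: "1 \<le> k" "k \<cdot> b + c + t = k \<cdot> a + t"
    using assms by (auto simp: difference_zero difference_le qle_def)
  have "envelope_of (k \<cdot> b + c + t) = envelope_of (k \<cdot> a + t)"
    unfolding k(2) ..
  then have "envelope_of c = envelope_of (k \<cdot> a) - envelope_of (k \<cdot> b)"
    by (simp add: envelope_of_add algebra_simps)
  then have "k \<cdot> x = envelope_of c"
    unfolding x difference_nmult by (simp only: difference_envelope_of)
  then show thesis
    using that k(1) by blast
qed

lemma infinitesimal_imp_qequiv:
  assumes "infinitesimal (envelope_of a - envelope_of b)"
  shows "a \<approx> b"
proof -
  obtain D where D: "small D (envelope_of a - envelope_of b)"
    using assms by (auto simp: infinitesimal_def)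
  obtain p q where pq: "D = envelope_of p - envelope_of q" by (rule envelope_cases)
  have "D \<le> envelope_of p"
    using envelope_of_nonneg[of q] by (simp add: pq)
  from small_mono[OF D this] have p: "small (envelope_of p) (envelope_of a - envelope_of b)" .
  have "l \<cdot> a \<lesssim> l \<cdot> b + p \<and> l \<cdot> b \<lesssim> l \<cdot> a + p" if "1 \<le> l" for l :: nat
  proof -
    have "int l \<star> (envelope_of a - envelope_of b) \<le> envelope_of p"
      "int l \<star> - (envelope_of a - envelope_of b) \<le> envelope_of p"
      using p that by (simp_all add: small_def negligible_def)
    then show ?thesis
      by (simp add: scale_diff_right scale_of_nat diff_le_eq flip: envelope_of_le envelope_of_add)
        (simp add: envelope_of_add envelope_of_nmult add.commute)
  qed
  then show ?thesis
    unfolding qequiv_def by blast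
qed

text \<open>
  The value does not depend on the differences chosen for \<open>x\<close> and \<open>y\<close> if \<open>\<mu>\<close> is biadditive. As \<open>\<mu>\<close>
  is a parameter, this cannot be part of the definition, hence the choice.
\<close>

definition envelope_mul ::
    "('a::comm_monoid_add \<Rightarrow> 'a \<Rightarrow> 'a) \<Rightarrow> 'a envelope \<Rightarrow> 'a envelope \<Rightarrow> 'a envelope"
  where "envelope_mul \<mu> x y = (SOME z. \<exists>a b c d.
    x = envelope_of a - envelope_of b \<and> y = envelope_of c - envelope_of d \<and>
    z = envelope_of (\<mu> a c) + envelope_of (\<mu> b d) - envelope_of (\<mu> a d) - envelope_of (\<mu> b c))"

context
  fixes \<mu> :: "'a::comm_monoid_add \<Rightarrow> 'a \<Rightarrow> 'a"
  assumes biadditive: "biadditive \<mu>"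
begin

lemma mu_add: "\<mu> (a + b) c = \<mu> a c + \<mu> b c" "\<mu> a (b + c) = \<mu> a b + \<mu> a c"
  using biadditive by (simp_all add: biadditive_def additive_map_def)

lemma envelope_of_mu_cong_left:
  "envelope_of a = envelope_of b \<Longrightarrow> envelope_of (\<mu> a c) = envelope_of (\<mu> b c)"
  using biadditive qle_image[of "\<lambda>a. \<mu> a c"] unfolding biadditive_def
  by (metis envelope_of_le order_antisym order_refl)

lemma envelope_of_mu_cong_right:
  "envelope_of a = envelope_of b \<Longrightarrow> envelope_of (\<mu> c a) = envelope_of (\<mu> c b)"
  using biadditive qle_image[of "\<lambda>a. \<mu> c a"] unfolding biadditive_def
  by (metis envelope_of_le order_antisym order_refl)

lemma envelope_mul_difference:
  "envelope_mul \<mu> (envelope_of a - envelope_of b) (envelope_of c - envelope_of d) =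
    envelope_of (\<mu> a c) + envelope_of (\<mu> b d) - envelope_of (\<mu> a d) - envelope_of (\<mu> b c)"
proof -
  have "envelope_of (\<mu> a' c') + envelope_of (\<mu> b' d') - envelope_of (\<mu> a' d') - envelope_of (\<mu> b' c')
      = envelope_of (\<mu> a c) + envelope_of (\<mu> b d) - envelope_of (\<mu> a d) - envelope_of (\<mu> b c)"
    if "envelope_of a - envelope_of b = envelope_of a' - envelope_of b'"
      "envelope_of c - envelope_of d = envelope_of c' - envelope_of d'" for a' b' c' d'
  proof -
    have "envelope_of (a + b') = envelope_of (a' + b)" "envelope_of (c + d') = envelope_of (c' + d)"
      using that by (simp_all add: envelope_of_add algebra_simps)
    note l = envelope_of_mu_cong_left[OF this(1)] and r = envelope_of_mu_cong_right[OF this(2)]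
    have left: "envelope_of (\<mu> a' x) - envelope_of (\<mu> b' x) = envelope_of (\<mu> a x) - envelope_of (\<mu> b x)" for x
      using l[of x] by (simp add: mu_add envelope_of_add algebra_simps)
    have right: "envelope_of (\<mu> x c') - envelope_of (\<mu> x d') = envelope_of (\<mu> x c) - envelope_of (\<mu> x d)" for x
      using r[of x] by (simp add: mu_add envelope_of_add algebra_simps)
    have "envelope_of (\<mu> a' c') + envelope_of (\<mu> b' d') - envelope_of (\<mu> a' d') - envelope_of (\<mu> b' c')
        = (envelope_of (\<mu> a' c') - envelope_of (\<mu> b' c')) - (envelope_of (\<mu> a' d') - envelope_of (\<mu> b' d'))"
      by simp
    also have "\<dots> = (envelope_of (\<mu> a c') - envelope_of (\<mu> a d')) - (envelope_of (\<mu> b c') - envelope_of (\<mu> b d'))"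
      unfolding left by simp
    also have "\<dots> = envelope_of (\<mu> a c) + envelope_of (\<mu> b d) - envelope_of (\<mu> a d) - envelope_of (\<mu> b c)"
      unfolding right by simp
    finally show ?thesis .
  qed
  then show ?thesis
    unfolding envelope_mul_def by (intro some_equality) (blast, metis)
qed

text \<open>
  An additive map need not preserve \<open>0\<close>, but \<open>\<mu> a 0\<close> is idempotent under addition and therefore
  vanishes in a group.
\<close>

lemma envelope_of_mu_zero: "envelope_of (\<mu> a 0) = 0" "envelope_of (\<mu> 0 a) = 0"
proof -
  have "envelope_of (\<mu> a (0 + 0)) = envelope_of (\<mu> a 0) + envelope_of (\<mu> a 0)"
    by (simp only: mu_add envelope_of_add)
  then show "envelope_of (\<mu> a 0) = 0"
    unfolding add_0 using add_cancel_right_right by blast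
  have "envelope_of (\<mu> (0 + 0) a) = envelope_of (\<mu> 0 a) + envelope_of (\<mu> 0 a)"
    by (simp only: mu_add envelope_of_add)
  then show "envelope_of (\<mu> 0 a) = 0"
    unfolding add_0 using add_cancel_right_right by blast
qed

lemma envelope_of_zero: "envelope_of 0 = (0 :: 'a envelope)"
  by (simp add: envelope_of_def difference_zero)

lemma envelope_mul_envelope_of: "envelope_mul \<mu> (envelope_of a) (envelope_of b) = envelope_of (\<mu> a b)"
  using envelope_mul_difference[of a 0 b 0] by (simp add: envelope_of_zero envelope_of_mu_zero)

lemma envelope_mul_add:
  "envelope_mul \<mu> (x + y) z = envelope_mul \<mu> x z + envelope_mul \<mu> y z"
  "envelope_mul \<mu> z (x + y) = envelope_mul \<mu> z x + envelope_mul \<mu> z y"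
proof -
  obtain a b where x: "x = envelope_of a - envelope_of b" by (rule envelope_cases)
  obtain c d where y: "y = envelope_of c - envelope_of d" by (rule envelope_cases)
  obtain e f where z: "z = envelope_of e - envelope_of f" by (rule envelope_cases)
  have xy: "x + y = envelope_of (a + c) - envelope_of (b + d)"
    by (simp add: x y envelope_of_add)
  show "envelope_mul \<mu> (x + y) z = envelope_mul \<mu> x z + envelope_mul \<mu> y z"
    unfolding xy unfolding x y z envelope_mul_difference by (simp add: mu_add envelope_of_add algebra_simps)
  show "envelope_mul \<mu> z (x + y) = envelope_mul \<mu> z x + envelope_mul \<mu> z y"
    unfolding xy unfolding x y z envelope_mul_difference by (simp add: mu_add envelope_of_add algebra_simps)
qed

lemma envelope_mul_additive:
  "additive_op (\<lambda>x. envelope_mul \<mu> x y)" "additive_op (\<lambda>x. envelope_mul \<mu> y x)"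
  by (simp_all add: additive_op_def envelope_mul_add)

text \<open>
  Suitable multiples of both factors come from the monoid, and so does their product.
\<close>

lemma envelope_mul_nonneg:
  assumes "0 \<le> x" "0 \<le> y"
  shows "0 \<le> envelope_mul \<mu> x y"
proof -
  obtain k c where k: "1 \<le> k" "k \<cdot> x = envelope_of c"
    using assms(1) by (rule nonneg_multiple_envelope_of)
  obtain l e where l: "1 \<le> l" "l \<cdot> y = envelope_of e"
    using assms(2) by (rule nonneg_multiple_envelope_of)
  have "(k * l) \<cdot> envelope_mul \<mu> x y = envelope_mul \<mu> (k \<cdot> x) (l \<cdot> y)"
    by (simp add: additive_op_nmult[OF envelope_mul_additive(1)]
        additive_op_nmult[OF envelope_mul_additive(2)] nmult_nmult mult.commute)
  also have "\<dots> = envelope_of (\<mu> c e)"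
    unfolding k(2) l(2) by (rule envelope_mul_envelope_of)
  finally have "0 \<le> (k * l) \<cdot> envelope_mul \<mu> x y"
    using envelope_of_nonneg by simp
  then show ?thesis
    using unperforated[of "k * l"] mult_le_mono[OF k(1) l(1)] by (simp add: nmult_def)
qed

lemma envelope_localizing:
  assumes "left_localizable \<mu> s"
  shows "localizing (\<lambda>x. envelope_mul \<mu> (envelope_of s) x)"
  unfolding localizing_def
proof (intro conjI allI impI)
  show "positive_op (\<lambda>x. envelope_mul \<mu> (envelope_of s) x)"
    by (rule positive_opI) (simp_all add: envelope_mul_add envelope_mul_nonneg envelope_of_nonneg)
  fix x :: "'a envelope"
  assume le: "0 \<le> x + envelope_mul \<mu> (envelope_of s) x"
  obtain a b where x: "x = envelope_of a - envelope_of b" by (rule envelope_cases)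
  have "0 \<le> envelope_of (\<mu> s a + a) - envelope_of (\<mu> s b + b)"
    using le unfolding x additive_op_diff[OF envelope_mul_additive(2)] envelope_mul_envelope_of envelope_of_add
    by (simp add: algebra_simps)
  then have "\<mu> s b + b \<lesssim> \<mu> s a + a"
    by (simp only: diff_ge_0_iff_ge envelope_of_le)
  then have "b \<lesssim> a"
    using assms unfolding left_localizable_def by blast
  then show "0 \<le> x"
    by (simp only: x diff_ge_0_iff_ge envelope_of_le)
qed

end

lemma biadditive_opposite: "biadditive \<mu> \<Longrightarrow> biadditive (opposite \<mu>)"
  by (simp add: biadditive_def opposite_def)

lemma envelope_mul_opposite:
  assumes "biadditive \<mu>"
  shows "envelope_mul (opposite \<mu>) x y = envelope_mul \<mu> y x"
proof -
  obtain a b where x: "x = envelope_of a - envelope_of b" by (rule envelope_cases)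
  obtain c d where y: "y = envelope_of c - envelope_of d" by (rule envelope_cases)
  show ?thesis
    unfolding x y envelope_mul_difference[OF assms] envelope_mul_difference[OF biadditive_opposite[OF assms]]
    by (simp add: opposite_def algebra_simps)
qed

lemma envelope_localizable_product:
  assumes \<mu>: "biadditive \<mu>" "weakly_localizable \<mu>"
  shows "localizable_product (envelope_mul \<mu>)"
proof
  fix x :: "'a envelope"
  assume "0 \<le> x"
  obtain a b where x: "x = envelope_of a - envelope_of b" by (rule envelope_cases)
  obtain s where s: "localizable \<mu> s" "a \<lesssim> s"
    using \<mu>(2) unfolding weakly_localizable_def by blast
  have "x \<le> envelope_of s"
    using envelope_of_nonneg[of b] s(2) by (simp add: x diff_le_eq add_increasing2 flip: envelope_of_le)
  moreover have "localizing (\<lambda>x. envelope_mul \<mu> (envelope_of s) x)"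
    using s(1) by (simp add: localizable_def envelope_localizing[OF \<mu>(1)])
  moreover have "localizing (\<lambda>x. envelope_mul (opposite \<mu>) (envelope_of s) x)"
    using s(1) by (simp add: localizable_def envelope_localizing[OF biadditive_opposite[OF \<mu>(1)]])
  ultimately show "\<exists>s\<ge>x. localizing (\<lambda>x. envelope_mul \<mu> s x) \<and> localizing (\<lambda>x. envelope_mul \<mu> x s)"
    unfolding envelope_mul_opposite[OF \<mu>(1)] by blast
qed (simp_all add: envelope_mul_add[OF \<mu>(1)] envelope_mul_nonneg[OF \<mu>(1)])

theorem theorem12:
  fixes \<mu> :: "'a::comm_monoid_add \<Rightarrow> 'a \<Rightarrow> 'a"
  assumes "biadditive \<mu>"
    and "weakly_localizable \<mu>"
  shows "\<forall>a b c. \<mu> a b \<approx> \<mu> b a \<and> \<mu> (\<mu> a b) c \<approx> \<mu> a (\<mu> b c)"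
proof (intro allI conjI)
  fix a b c :: 'a
  interpret localizable_product "envelope_mul \<mu>"
    using assms by (rule envelope_localizable_product)
  note [simp] = envelope_mul_envelope_of[OF assms(1)]
  show "\<mu> a b \<approx> \<mu> b a"
    using commutator_infinitesimal[OF envelope_of_nonneg[of a] envelope_of_nonneg[of b]]
    by (intro infinitesimal_imp_qequiv) simp
  show "\<mu> (\<mu> a b) c \<approx> \<mu> a (\<mu> b c)"
    using associator_infinitesimal[OF envelope_of_nonneg[of a] envelope_of_nonneg[of b] envelope_of_nonneg[of c]]
    by (intro infinitesimal_imp_qequiv) simp
qed

end
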